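(* A finite graph is the intersection graph of a touching grounded configuration of strings if and only if it is outerplanar.
   Context: Fix a horizontal line, the grounding line. A string is a curve in the plane. A configuration of strings is grounded if all strings lie in the closed half-plane above the grounding line, each touches the grounding line in at least one point, and no two strings touch the grounding line at the same point. It is touching grounded if moreover any two strings may only touch and never cross: the drawing could be kept, up to infinitesimal changes, if every string were replaced by a thin region with non-empty interior, these regions meeting only on their boundaries. The intersection graph of a configuration has one vertex per string, two vertices being adjacent iff the corresponding strings intersect. *)

theory Defs
  imports "HOL-Analysis.Analysis"
begin

text \<open>
  Graphs are finite and simple. They are given by a vertex set and a set of two-element sets of
  vertices. The plane is the type of complex numbers.
\<close>

definition finite_graph :: "'a set \<Rightarrow> 'a set set \<Rightarrow> bool" where
  "finite_graph V E \<longleftrightarrow> finite V \<and> E \<subseteq> {e. e \<subseteq> V \<and> card e = 2}"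

definition intersection_edges :: "'a set \<Rightarrow> ('a \<Rightarrow> complex set) \<Rightarrow> 'a set set" where
  "intersection_edges V S = {{u, v} | u v. u \<in> V \<and> v \<in> V \<and> u \<noteq> v \<and> S u \<inter> S v \<noteq> {}}"

definition grounded :: "real \<Rightarrow> 'a set \<Rightarrow> ('a \<Rightarrow> complex set) \<Rightarrow> bool" where
  "grounded h V S \<longleftrightarrow>
     (\<forall>v\<in>V. S v \<subseteq> {z. h \<le> Im z}) \<and>
     (\<forall>v\<in>V. S v \<inter> {z. Im z = h} \<noteq> {}) \<and>
     (\<forall>u\<in>V. \<forall>v\<in>V. u \<noteq> v \<longrightarrow> S u \<inter> S v \<inter> {z. Im z = h} = {})"

definition grounded_strings :: "real \<Rightarrow> 'a set \<Rightarrow> ('a \<Rightarrow> real \<Rightarrow> complex) \<Rightarrow> bool" where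
  "grounded_strings h V \<gamma> \<longleftrightarrow> (\<forall>v\<in>V. path (\<gamma> v)) \<and> grounded h V (\<lambda>v. path_image (\<gamma> v))"

text \<open>
  A string of positive thickness: the closed neighbourhood of radius \<open>r\<close> of a curve.
\<close>

definition thick_string :: "(real \<Rightarrow> complex) \<Rightarrow> real \<Rightarrow> complex set" where
  "thick_string g r = (\<Union>z\<in>path_image g. cball z r)"

text \<open>
  Strings touch without crossing if, for every \<open>\<epsilon> > 0\<close>, moving each curve by less than \<open>\<epsilon>\<close> and
  thickening it by a positive radius less than \<open>\<epsilon>\<close> can be done in such a way that distinct thick
  strings meet at most in boundary points, while the drawing is kept: it is still grounded, and
  the same pairs meet. The thick strings are required to be neighbourhoods of curves, rather than
  arbitrary thin regions, because otherwise arbitrarily many regions tapering to a cusp could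
  pairwise meet in one common boundary point, and every complete graph would be realised.
  Neighbourhoods with disjoint interiors have no point common to three of them.
\<close>

definition touching :: "real \<Rightarrow> 'a set \<Rightarrow> ('a \<Rightarrow> real \<Rightarrow> complex) \<Rightarrow> bool" where
  "touching h V \<gamma> \<longleftrightarrow>
     (\<forall>\<epsilon>>0. \<exists>\<gamma>' r.
        (\<forall>v\<in>V. path (\<gamma>' v) \<and> (\<forall>t\<in>{0..1}. dist (\<gamma>' v t) (\<gamma> v t) < \<epsilon>) \<and> 0 < r v \<and> r v < \<epsilon>) \<and>
        grounded h V (\<lambda>v. thick_string (\<gamma>' v) (r v)) \<and>
        (\<forall>u\<in>V. \<forall>v\<in>V. u \<noteq> v \<longrightarrow>
           thick_string (\<gamma>' u) (r u) \<inter> thick_string (\<gamma>' v) (r v)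
             \<subseteq> frontier (thick_string (\<gamma>' u) (r u)) \<inter> frontier (thick_string (\<gamma>' v) (r v)) \<and>
           (thick_string (\<gamma>' u) (r u) \<inter> thick_string (\<gamma>' v) (r v) \<noteq> {}
             \<longleftrightarrow> path_image (\<gamma> u) \<inter> path_image (\<gamma> v) \<noteq> {})))"

definition touching_grounded_strings :: "real \<Rightarrow> 'a set \<Rightarrow> ('a \<Rightarrow> real \<Rightarrow> complex) \<Rightarrow> bool" where
  "touching_grounded_strings h V \<gamma> \<longleftrightarrow> grounded_strings h V \<gamma> \<and> touching h V \<gamma>"

text \<open>
  A plane drawing: vertices are distinct points, and edges are simple arcs that join their end
  vertices and meet vertices and each other only in common end vertices.
\<close>

definition plane_drawing ::
  "'a set \<Rightarrow> 'a set set \<Rightarrow> ('a \<Rightarrow> complex) \<Rightarrow> ('a set \<Rightarrow> real \<Rightarrow> complex) \<Rightarrow> bool" where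
  "plane_drawing V E p c \<longleftrightarrow>
     inj_on p V \<and>
     (\<forall>e\<in>E. arc (c e) \<and> {pathstart (c e), pathfinish (c e)} = p ` e \<and>
             path_image (c e) \<inter> p ` V = p ` e) \<and>
     (\<forall>e\<in>E. \<forall>f\<in>E. e \<noteq> f \<longrightarrow> path_image (c e) \<inter> path_image (c f) \<subseteq> p ` (e \<inter> f))"

definition drawing_points ::
  "'a set \<Rightarrow> 'a set set \<Rightarrow> ('a \<Rightarrow> complex) \<Rightarrow> ('a set \<Rightarrow> real \<Rightarrow> complex) \<Rightarrow> complex set" where
  "drawing_points V E p c = p ` V \<union> (\<Union>e\<in>E. path_image (c e))"

text \<open>
  The drawing of a finite graph is compact, so \<^const>\<open>outside\<close> of it is its unique unbounded face.
\<close>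

definition outerplanar :: "'a set \<Rightarrow> 'a set set \<Rightarrow> bool" where
  "outerplanar V E \<longleftrightarrow>
     (\<exists>p c. plane_drawing V E p c \<and> p ` V \<subseteq> frontier (outside (drawing_points V E p c)))"

end

theory Submission
  imports Defs
begin

text \<open>
  Both sides are equivalent to the existence of a linear order of the vertices in which no two
  edges \<open>ac\<close> and \<open>bd\<close> satisfy \<open>a < b < c < d\<close>. For touching grounded strings the order of the
  grounding points works: two crossing edges would give two interlaced curves in the half-plane,
  which meet, although thick strings share no interior points and no three of them have a common
  point. Conversely, such an order gives straight chords of a parabola, and comb-shaped strings.

  An outerplanar drawing has no vertex inside a cycle, and one arc of a theta curve is inside the
  Jordan curve of the other two. Hence three internally disjoint paths with the same ends cannot
  all have interior vertices, so that in a graph without cut vertices a longest cycle contains all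
  vertices. All other edges are then inside this cycle, and the order along the cycle works. At a
  cut vertex, orders of the two parts that start at this vertex are concatenated.
\<close>

subsection \<open>Noncrossing orders\<close>

text \<open>Plane topology and graph theory meet in few places. \<open>noncrossing_exists\<close> is
  purely combinatorial: it asks only that three paths as above and two interlaced chords of a cycle
  do not occur. For a drawing, both exclusions rest on one fact, \<open>not_inside_trace\<close>,
  applied to arbitrary subsets of the edges.

  In the string direction the given curves may overlap in any manner, so the argument replaces them
  by one thickened perturbation. A curve that joins the grounding points of two adjacent thick
  strings can be kept in their open parts except at three points: the two grounding points and one
  contact point. Only these have to be examined when two such curves meet.

  The order is encoded by natural numbers because the positions also serve as coordinates, for the
  parabola and for the combs; there the unit gaps leave room for the thickness of the
  strings.\<close>

definition noncrossing :: "'a set \<Rightarrow> 'a set set \<Rightarrow> ('a \<Rightarrow> nat) \<Rightarrow> bool" where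
  "noncrossing V E pos \<longleftrightarrow> inj_on pos V \<and>
     (\<forall>a\<in>V. \<forall>b\<in>V. \<forall>c\<in>V. \<forall>d\<in>V. pos a < pos b \<longrightarrow> pos b < pos c \<longrightarrow> pos c < pos d \<longrightarrow>
        \<not> ({a, c} \<in> E \<and> {b, d} \<in> E))"

lemma noncrossingD:
  assumes "noncrossing V E pos" "a \<in> V" "b \<in> V" "c \<in> V" "d \<in> V"
    "pos a < pos b" "pos b < pos c" "pos c < pos d" "{a, c} \<in> E" "{b, d} \<in> E"
  shows False
  using assms unfolding noncrossing_def by blast

lemma finite_strict_bound:
  fixes f :: "'a \<Rightarrow> nat"
  assumes "finite A"
  obtains K where "\<And>v. v \<in> A \<Longrightarrow> f v < K"
proof
  show "f v < Suc (Max (f ` A))" if "v \<in> A" for v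
    using that assms by (simp add: less_Suc_eq_le)
qed

text \<open>Whether two edges interlace depends only on the cyclic order of their ends, so the
  circle of vertices may be cut open just before x.\<close>

lemma noncrossing_rotate:
  assumes nc: "noncrossing A E pos" and "finite A"
  obtains pos' where "noncrossing A E pos'" "\<And>v. x \<in> A \<Longrightarrow> v \<in> A \<Longrightarrow> pos' x \<le> pos' v"
proof -
  obtain K where K: "\<And>v. v \<in> A \<Longrightarrow> pos v < K"
    using finite_strict_bound[OF \<open>finite A\<close>] by blast
  \<comment> \<open>K exceeds all positions, so the vertices that preceded x now follow all
    others.\<close>
  define pos' where "pos' v = (if pos v < pos x then pos v + K else pos v)" for v
  have inj: "inj_on pos A"
    using nc by (simp add: noncrossing_def)
  show thesis
  proof
    show "pos' x \<le> pos' v" if "x \<in> A" "v \<in> A" for v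
      using K[OF that(1)] by (auto simp: pos'_def)
    show "noncrossing A E pos'"
      unfolding noncrossing_def
    proof (intro conjI ballI impI notI)
      show "inj_on pos' A"
      proof (rule inj_onI)
        fix u v assume "u \<in> A" "v \<in> A" "pos' u = pos' v"
        then have "pos u = pos v"
          using K[of u] K[of v] by (auto simp: pos'_def split: if_splits)
        then show "u = v"
          using inj \<open>u \<in> A\<close> \<open>v \<in> A\<close> by (simp add: inj_onD)
      qed
      fix a b c d
      assume V: "a \<in> A" "b \<in> A" "c \<in> A" "d \<in> A"
        and lt: "pos' a < pos' b" "pos' b < pos' c" "pos' c < pos' d"
        and e: "{a, c} \<in> E \<and> {b, d} \<in> E"
      have e': "{a, c} \<in> E" "{c, a} \<in> E" "{b, d} \<in> E" "{d, b} \<in> E"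
        using e by (auto simp: insert_commute)
      note KK = K[OF V(1)] K[OF V(2)] K[OF V(3)] K[OF V(4)]
      \<comment> \<open>The old order of the four vertices is a cyclic shift of the new one, and in
        each shift the same two edges interlace.\<close>
      have "pos a < pos b \<and> pos b < pos c \<and> pos c < pos d \<or>
            pos b < pos c \<and> pos c < pos d \<and> pos d < pos a \<or>
            pos c < pos d \<and> pos d < pos a \<and> pos a < pos b \<or>
            pos d < pos a \<and> pos a < pos b \<and> pos b < pos c"
        using lt KK unfolding pos'_def by (smt (verit) add_less_cancel_right trans_less_add2 not_less_iff_gr_or_eq order.strict_trans less_trans)
      then show False
        using noncrossingD[OF nc] V e' by blast
    qed
  qed
qed

text \<open>Both orders are rotated to start at x and then concatenated. If an edge of A and an edge
  of B interlaced, one of the two middle vertices would lie in both sets, hence be x, but x has no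
  predecessor.\<close>

lemma noncrossing_glue:
  assumes ncA: "noncrossing A E posA" and ncB: "noncrossing B E posB"
    and "finite A" "finite B"
    and E: "\<And>e. e \<in> E \<Longrightarrow> e \<subseteq> A \<union> B \<Longrightarrow> e \<subseteq> A \<or> e \<subseteq> B"
    and x: "A \<inter> B \<subseteq> {x}"
  obtains pos where "noncrossing (A \<union> B) E pos"
proof -
  obtain pA where pA: "noncrossing A E pA" and minA: "\<And>v. x \<in> A \<Longrightarrow> v \<in> A \<Longrightarrow> pA x \<le> pA v"
    using noncrossing_rotate[OF ncA \<open>finite A\<close>] by blast
  obtain pB where pB: "noncrossing B E pB" and minB: "\<And>v. x \<in> B \<Longrightarrow> v \<in> B \<Longrightarrow> pB x \<le> pB v"
    using noncrossing_rotate[OF ncB \<open>finite B\<close>] by blast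
  obtain K where K: "\<And>v. v \<in> A \<Longrightarrow> pA v < K"
    using finite_strict_bound[OF \<open>finite A\<close>] by blast
  define pos where "pos v = (if v \<in> A then pA v else pB v + K)" for v
  have injA: "inj_on pA A" and injB: "inj_on pB B"
    using pA pB by (simp_all add: noncrossing_def)
  have posA: "pos v = pA v" if "v \<in> A" for v
    using that by (simp add: pos_def)
  have AB: "v \<in> A" if "pos v < pos u" "u \<in> A" for u v
    using that K[of u] by (auto simp: pos_def split: if_splits)
  \<comment> \<open>The only vertex of B that takes its position from A is x. It is least in
    \<open>pB\<close>, and all other vertices of B come after A.\<close>
  have posB: "pB u < pB v" if "u \<in> B" "v \<in> B" "pos u < pos v" for u v
  proof (cases "v \<in> A")
    case True
    then have "u = x" "v = x" using that AB[OF that(3)] x by auto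
    then show ?thesis using that by simp
  next
    case v: False
    show ?thesis
    proof (cases "u \<in> A")
      case True
      then have "u = x" using that x by auto
      then have "pB u \<noteq> pB v" "pB u \<le> pB v" 
        using that minB True v injB by (auto dest: inj_onD)
      then show ?thesis by simp
    next
      case False
      then show ?thesis using that v by (simp add: pos_def)
    qed
  qed
  have xmin: "\<not> pos v < pos x" if "x \<in> A" "x \<in> B" "v \<in> A \<union> B" for v
  proof
    assume "pos v < pos x"
    with AB \<open>x \<in> A\<close> have "v \<in> A" by blast
    with minA[of v] \<open>pos v < pos x\<close> \<open>x \<in> A\<close> show False by (simp add: posA)
  qed
  show thesis
  proof
    show "noncrossing (A \<union> B) E pos"
      unfolding noncrossing_def
    proof (intro conjI ballI impI notI)
      show "inj_on pos (A \<union> B)"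
      proof (rule inj_onI)
        fix u v assume uv: "u \<in> A \<union> B" "v \<in> A \<union> B" "pos u = pos v"
        show "u = v"
        proof (cases "u \<in> A \<longleftrightarrow> v \<in> A")
          case True
          then show ?thesis
            using uv injA injB by (auto simp: pos_def inj_on_eq_iff split: if_splits)
        next
          case False
          then show ?thesis
            using uv K[of u] K[of v] by (auto simp: pos_def)
        qed
      qed
      fix a b c d
      assume V: "a \<in> A \<union> B" "b \<in> A \<union> B" "c \<in> A \<union> B" "d \<in> A \<union> B"
        and lt: "pos a < pos b" "pos b < pos c" "pos c < pos d"
        and e: "{a, c} \<in> E \<and> {b, d} \<in> E"
      have ac: "{a, c} \<subseteq> A \<or> {a, c} \<subseteq> B" and bd: "{b, d} \<subseteq> A \<or> {b, d} \<subseteq> B"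
        using e V E[of "{a, c}"] E[of "{b, d}"] by auto
      consider "{a, c} \<subseteq> A" "{b, d} \<subseteq> A" | "{a, c} \<subseteq> B" "{b, d} \<subseteq> B"
        | "{a, c} \<subseteq> A" "{b, d} \<subseteq> B" | "{a, c} \<subseteq> B" "{b, d} \<subseteq> A"
        using ac bd by blast
      then show False
      proof cases
        case 1
        then show False
          using noncrossingD[OF pA, of a b c d] lt e by (simp add: posA)
      next
        case 2
        then show False
          using noncrossingD[OF pB, of a b c d] lt e posB by simp
      next
        case 3
        then have "b \<in> A" using AB lt by blast
        then have "b = x" using 3 x by blast
        then show False using xmin[of a] lt 3 \<open>b \<in> A\<close> by auto
      next
        case 4
        then have "c \<in> A" using AB lt by blast
        then have "c = x" using 4 x by blast
        then show False using xmin[of b] lt 4 \<open>c \<in> A\<close> by auto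
      qed
    qed
  qed
qed

section \<open>Walks and cycles as vertex lists\<close>

fun walk_edges :: "'a list \<Rightarrow> 'a set set" where
  "walk_edges (x # y # zs) = insert {x, y} (walk_edges (y # zs))"
| "walk_edges _ = {}"

lemma walk_edge_subset: "e \<in> walk_edges xs \<Longrightarrow> e \<subseteq> set xs"
  by (induction xs rule: walk_edges.induct) auto

lemma Union_walk_edges: "length xs \<ge> 2 \<Longrightarrow> \<Union>(walk_edges xs) = set xs"
proof (induction xs rule: walk_edges.induct)
  case (1 x y zs)
  then show ?case by (cases zs) auto
qed auto

lemma walk_edges_append: "walk_edges (xs @ y # ys) = walk_edges (xs @ [y]) \<union> walk_edges (y # ys)"
proof (induction xs)
  case Nil
  then show ?case by simp
next
  case (Cons x xs)
  then show ?case by (cases xs) auto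
qed

lemma walk_edges_rev: "walk_edges (rev xs) = walk_edges xs"
proof (induction xs rule: walk_edges.induct)
  case (1 x y zs)
  have "walk_edges (rev (x # y # zs)) = walk_edges (rev zs @ [y]) \<union> walk_edges [y, x]"
    using walk_edges_append[of "rev zs" y "[x]"] by simp
  then show ?case using 1 by (auto simp: insert_commute)
qed auto

text \<open>Makes walks with the same ends and disjoint interiors edge-disjoint as soon as one of
  them has an interior vertex.\<close>

lemma walk_edges_meet_interior:
  assumes "e \<in> walk_edges (a # ys @ [b])" "ys \<noteq> []"
  shows "e \<inter> set ys \<noteq> {}"
proof -
  have "e \<in> walk_edges (ys @ [b]) \<Longrightarrow> ys \<noteq> [] \<Longrightarrow> e \<inter> set ys \<noteq> {}"
  proof (induction ys)
    case (Cons y ys)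
    then show ?case by (cases ys) auto
  qed simp
  then show ?thesis using assms by (cases ys) auto
qed

definition cycle_in :: "'a set set \<Rightarrow> 'a list \<Rightarrow> bool" where
  "cycle_in E xs \<longleftrightarrow> distinct xs \<and> 2 \<le> length xs \<and> walk_edges (xs @ [hd xs]) \<subseteq> E"

lemma cycle_in_rotate:
  assumes "cycle_in E (us @ a # vs)"
  shows "cycle_in E (a # vs @ us)"
proof (cases us)
  case Nil
  then show ?thesis using assms by simp
next
  case (Cons h us')
  have "walk_edges (h # us' @ a # vs @ [h]) = walk_edges (h # us' @ [a]) \<union> walk_edges (a # vs @ [h])"
    using walk_edges_append[of "h # us'" a "vs @ [h]"] by simp
  moreover have "walk_edges (a # vs @ h # us' @ [a]) = walk_edges (a # vs @ [h]) \<union> walk_edges (h # us' @ [a])"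
    using walk_edges_append[of "a # vs" h "us' @ [a]"] by simp
  ultimately show ?thesis
    using assms Cons by (auto simp: cycle_in_def)
qed

lemma rtrancl_distinct_walk:
  assumes "(u, v) \<in> R\<^sup>*" "u \<in> S"
    and R: "\<And>x y. (x, y) \<in> R \<Longrightarrow> {x, y} \<in> E \<and> y \<in> S"
  obtains ks where "distinct ks" "ks \<noteq> []" "hd ks = u" "last ks = v" "set ks \<subseteq> S" "walk_edges ks \<subseteq> E"
proof -
  have "\<exists>ks. distinct ks \<and> ks \<noteq> [] \<and> hd ks = u \<and> last ks = v \<and> set ks \<subseteq> S \<and> walk_edges ks \<subseteq> E"
    using assms(1)
  proof induction
    case base
    then show ?case using \<open>u \<in> S\<close> by (intro exI[of _ "[u]"]) auto
  next
    case (step y z)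
    then obtain ks where ks: "distinct ks" "ks \<noteq> []" "hd ks = u" "last ks = y" "set ks \<subseteq> S" "walk_edges ks \<subseteq> E"
      by blast
    show ?case
    proof (cases "z \<in> set ks")
      \<comment> \<open>When the walk returns to z, cutting it at the earlier occurrence keeps it
        free of repetitions.\<close>
      case True
      then obtain as bs where "ks = as @ z # bs"
        by (auto dest: split_list)
      then show ?thesis
        using ks walk_edges_append[of as z bs]
        by (intro exI[of _ "as @ [z]"]) (auto simp: hd_append split: if_splits)
    next
      case False
      have ksy: "ks = butlast ks @ [y]"
        using ks append_butlast_last_id by metis
      then have "walk_edges (ks @ [z]) = walk_edges ks \<union> {{y, z}}"
        using walk_edges_append[of "butlast ks" y "[z]"] by (metis append.assoc append_Cons append_Nil walk_edges.simps(1) walk_edges.simps(3))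
      then show ?thesis
        using ks False R[OF step(2)] by (intro exI[of _ "ks @ [z]"]) auto
    qed
  qed
  then show thesis using that by blast
qed

lemma list_split_four:
  assumes "i < j" "j < k" "k < l" "l < length xs"
  obtains X0 X1 X2 X3 X4 where "xs = X0 @ xs ! i # X1 @ xs ! j # X2 @ xs ! k # X3 @ xs ! l # X4"
proof -
  have split: "\<exists>X1 X2. ys = X1 @ ys ! n # X2 \<and> length X1 = n" if "n < length ys" for n and ys :: "'a list"
    using id_take_nth_drop[OF that] that by (intro exI conjI) auto
  \<comment> \<open>Splitting from the right keeps the smaller indices valid in the remaining
    prefix.\<close>
  obtain Y3 X4 where 1: "xs = Y3 @ xs ! l # X4" "length Y3 = l" using split assms(4) by blast
  obtain Y2 X3 where 2: "Y3 = Y2 @ Y3 ! k # X3" "length Y2 = k" using split[of k Y3] assms 1 by auto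
  obtain Y1 X2 where 3: "Y2 = Y1 @ Y2 ! j # X2" "length Y1 = j" using split[of j Y2] assms 2 by auto
  obtain X0 X1 where 4: "Y1 = X0 @ Y1 ! i # X1" "length X0 = i" using split[of i Y1] assms 3 by auto
  have "Y3 ! k = xs ! k" "Y2 ! j = xs ! j" "Y1 ! i = xs ! i"
    using 1 2 3 4 assms by (metis nth_append order.strict_trans)+
  then have "xs = X0 @ xs ! i # X1 @ xs ! j # X2 @ xs ! k # X3 @ xs ! l # X4"
    using 1 2 3 4 by (metis append.assoc append_Cons)
  then show thesis using that by blast
qed

text \<open>The positions along the cycle work: edges with interlaced positions are crossing chords
  of the cycle rotated to start at the first of the four ends.\<close>

lemma noncrossing_cycle:
  assumes cyc: "cycle_in E xs"
    and no_crossing: "\<And>a A1 c A2 b A3 d A4. cycle_in E (a # A1 @ c # A2 @ b # A3 @ d # A4) \<Longrightarrow>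
          {a, b} \<in> E \<Longrightarrow> {c, d} \<in> E \<Longrightarrow> False"
  obtains pos where "noncrossing (set xs) E pos"
proof -
  have dist: "distinct xs" using cyc by (simp add: cycle_in_def)
  define pos where "pos = the_inv_into {..<length xs} ((!) xs)"
  have inj: "inj_on ((!) xs) {..<length xs}"
    using dist by (simp add: inj_on_nth)
  have im: "(!) xs ` {..<length xs} = set xs"
    by (auto simp: set_conv_nth)
  have pos: "pos v < length xs \<and> xs ! pos v = v" if "v \<in> set xs" for v
    using that the_inv_into_into[OF inj, of v] f_the_inv_into_f[OF inj, of v] im
    by (auto simp: pos_def)
  have "noncrossing (set xs) E pos"
    unfolding noncrossing_def
  proof (intro conjI ballI impI notI)
    show "inj_on pos (set xs)"
      using pos by (metis inj_onI)
    fix a c b d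
    assume V: "a \<in> set xs" "b \<in> set xs" "c \<in> set xs" "d \<in> set xs"
      and lt: "pos a < pos c" "pos c < pos b" "pos b < pos d"
      and e: "{a, b} \<in> E \<and> {c, d} \<in> E"
    obtain X0 X1 X2 X3 X4 where "xs = X0 @ a # X1 @ c # X2 @ b # X3 @ d # X4"
      using list_split_four[OF lt, of xs] pos V by metis
    then have "cycle_in E (a # X1 @ c # X2 @ b # X3 @ d # (X4 @ X0))"
      using cycle_in_rotate[of E X0 a "X1 @ c # X2 @ b # X3 @ d # X4"] cyc by simp
    then show False using no_crossing e by blast
  qed
  then show thesis using that by blast
qed

text \<open>A vertex off the cycle yields a detour between two cycle vertices a and b. With the two
  arcs of the cycle it forms three paths with the same ends.\<close>

lemma longest_cycle_spans:
  assumes fin: "finite W"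
    and E: "\<And>e. e \<in> E \<Longrightarrow> card e = 2"
    and no_theta: "\<And>a b ys1 ys2 ys3. \<lbrakk>distinct (a # ys1 @ [b]); distinct (a # ys2 @ [b]); distinct (a # ys3 @ [b]);
          walk_edges (a # ys1 @ [b]) \<subseteq> E; walk_edges (a # ys2 @ [b]) \<subseteq> E; walk_edges (a # ys3 @ [b]) \<subseteq> E;
          ys1 \<noteq> []; ys2 \<noteq> []; ys3 \<noteq> []; set ys1 \<inter> set ys2 = {}; set ys1 \<inter> set ys3 = {}; set ys2 \<inter> set ys3 = {}\<rbrakk> \<Longrightarrow> False"
    and insep: "\<And>A B x. \<lbrakk>A \<union> B = W; A \<noteq> W; B \<noteq> W; A \<inter> B \<subseteq> {x};
          \<And>e. e \<in> E \<Longrightarrow> e \<subseteq> W \<Longrightarrow> e \<subseteq> A \<or> e \<subseteq> B\<rbrakk> \<Longrightarrow> False"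
    and cyc: "cycle_in E xs" and sub: "set xs \<subseteq> W"
    and max: "\<And>zs. cycle_in E zs \<Longrightarrow> set zs \<subseteq> W \<Longrightarrow> length zs \<le> length xs"
  shows "set xs = W"
proof (rule ccontr)
  assume "set xs \<noteq> W"
  then obtain w where w: "w \<in> W" "w \<notin> set xs" using sub by blast
  define R where "R = {(x, y). {x, y} \<in> E \<and> x \<in> W - set xs \<and> y \<in> W - set xs}"
  define K where "K = {y. (w, y) \<in> R\<^sup>*}"
  define N where "N = {a \<in> set xs. \<exists>k\<in>K. {a, k} \<in> E}"
  have KW: "K \<subseteq> W - set xs"
  proof
    fix y assume "y \<in> K"
    then have "(w, y) \<in> R\<^sup>*" by (simp add: K_def)
    then show "y \<in> W - set xs"
      by (induction) (use w in \<open>auto simp: R_def\<close>)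
  qed
  have wK: "w \<in> K" by (simp add: K_def)
  have card2: "card (set xs) \<ge> 2"
    using cyc by (simp add: cycle_in_def distinct_card)
  \<comment> \<open>K is the component of w off the cycle and N the set of its neighbours on the
    cycle. With at most one neighbour, K \<union> N and W - K would be a separation; both are proper
    because the cycle has two vertices and w is in K.\<close>
  have "\<not> N \<subseteq> {x}" for x
  proof
    assume N: "N \<subseteq> {x}"
    show False
    proof (rule insep[of "K \<union> N" "W - K" x])
      show "K \<union> N \<union> (W - K) = W" using KW sub by (auto simp: N_def)
      show "K \<union> N \<noteq> W"
      proof
        assume "K \<union> N = W"
        then have "set xs \<subseteq> {x}" using KW sub N by blast
        then have "card (set xs) \<le> 1" using card_mono[of "{x}" "set xs"] by simp
        then show False using card2 by simp
      qed
      show "W - K \<noteq> W" using wK w by blast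
      show "(K \<union> N) \<inter> (W - K) \<subseteq> {x}" using N by blast
      fix e assume e: "e \<in> E" "e \<subseteq> W"
      obtain s t where st: "e = {s, t}" using E[OF e(1)] by (auto simp: card_2_iff)
      have *: "t \<in> K \<union> N" if "s \<in> K" "{s, t} \<in> E" "t \<in> W" for s t
      proof (cases "t \<in> set xs")
        case True
        then show ?thesis using that by (auto simp: N_def insert_commute)
      next
        case False
        then have "(s, t) \<in> R" using that KW by (auto simp: R_def)
        then show ?thesis using that by (auto simp: K_def)
      qed
      show "e \<subseteq> K \<union> N \<or> e \<subseteq> W - K"
        using *[of s t] *[of t s] e st by (auto simp: insert_commute)
    qed
  qed
  then obtain a b where ab: "a \<in> N" "b \<in> N" "a \<noteq> b" by blast
  obtain k1 k2 where k: "k1 \<in> K" "{a, k1} \<in> E" "k2 \<in> K" "{b, k2} \<in> E"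
    using ab by (auto simp: N_def)
  have "sym R" by (auto simp: R_def sym_def insert_commute)
  then have "(k1, k2) \<in> R\<^sup>*"
    using k by (metis K_def mem_Collect_eq rtrancl_trans sym_rtrancl symD)
  then obtain ks where ks: "distinct ks" "ks \<noteq> []" "hd ks = k1" "last ks = k2" "set ks \<subseteq> W - set xs" "walk_edges ks \<subseteq> E"
    by (rule rtrancl_distinct_walk[where S = "W - set xs" and E = E]) (use k KW in \<open>auto simp: R_def\<close>)
  have wks: "walk_edges (a # ks @ [b]) \<subseteq> E"
  proof -
    have "walk_edges (ks @ [b]) = walk_edges ks \<union> {{k2, b}}"
      using walk_edges_append[of "butlast ks" k2 "[b]"] append_butlast_last_id[OF ks(2)] ks(4)
      by (metis append.assoc append_Cons append_Nil walk_edges.simps(1) walk_edges.simps(3))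
    moreover have "walk_edges (a # ks @ [b]) = insert {a, k1} (walk_edges (ks @ [b]))"
      using ks(2,3) by (cases ks) auto
    ultimately show ?thesis using ks k by (auto simp: insert_commute)
  qed
  have abx: "a \<in> set xs" "b \<in> set xs" using ab by (auto simp: N_def)
  obtain us vs where "xs = us @ a # vs" using abx by (auto dest: split_list)
  define zs where "zs = vs @ us"
  have cz: "cycle_in E (a # zs)" and sz: "set (a # zs) = set xs" "length xs = Suc (length zs)"
    using cycle_in_rotate[of E us a vs] cyc \<open>xs = us @ a # vs\<close> by (auto simp: zs_def)
  have "b \<in> set zs" using sz abx ab by auto
  then obtain ys ts where zs: "zs = ys @ b # ts" by (auto dest: split_list)
  have dist: "distinct (a # ys @ b # ts)" using cz zs by (simp add: cycle_in_def)
  have ksd: "set ks \<inter> set (a # ys @ b # ts) = {}" using ks(5) sz(1) zs by auto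
  have w1: "walk_edges (a # ys @ [b]) \<subseteq> E" and w2: "walk_edges (b # ts @ [a]) \<subseteq> E"
    using cz walk_edges_append[of "a # ys" b "ts @ [a]"] by (auto simp: cycle_in_def zs)
  have subW: "set (a # ys @ b # ts) \<subseteq> W" using sz zs sub by auto
  \<comment> \<open>The interiors of the two arcs are ys and ts. An arc that is a single edge can be
    replaced by the detour ks, which lengthens the cycle; otherwise all three paths have interior
    vertices.\<close>
  consider "ys = []" | "ts = []" | "ys \<noteq> []" "ts \<noteq> []" by blast
  then show False
  proof cases
    case 1
    have "cycle_in E (a # ks @ b # ts)"
      using dist ksd ks wks w2 walk_edges_append[of "a # ks" b "ts @ [a]"]
      by (auto simp: cycle_in_def)
    then show False
      using max[of "a # ks @ b # ts"] ks subW sz zs 1 by (auto simp: Suc_le_eq)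
  next
    case 2
    have "walk_edges (b # rev ks @ [a]) \<subseteq> E"
      using wks walk_edges_rev[of "a # ks @ [b]"] by simp
    then have "cycle_in E (a # ys @ b # rev ks)"
      using dist ksd ks w1 walk_edges_append[of "a # ys" b "rev ks @ [a]"]
      by (auto simp: cycle_in_def)
    then show False
      using max[of "a # ys @ b # rev ks"] ks subW sz zs 2 by (auto simp: Suc_le_eq)
  next
    case 3
    have "walk_edges (a # rev ts @ [b]) \<subseteq> E"
      using w2 walk_edges_rev[of "b # ts @ [a]"] by simp
    moreover have "set ys \<inter> set ks = {}" "set (rev ts) \<inter> set ks = {}" "set ys \<inter> set (rev ts) = {}"
      using ksd dist by auto
    moreover have "distinct (a # ks @ [b])" "distinct (a # ys @ [b])" "distinct (a # rev ts @ [b])"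
      using dist ksd ks(1) by auto
    ultimately show False
      using no_theta[of a ys b "rev ts" ks] 3 ks(2) w1 wks by simp
  qed
qed

text \<open>The induction shrinks W while E stays fixed, so the excluded configurations carry over
  unchanged; a separation of W has to respect only the edges inside W.\<close>

lemma noncrossing_exists:
  assumes "finite W"
    and E: "\<And>e. e \<in> E \<Longrightarrow> card e = 2"
    and no_theta: "\<And>a b ys1 ys2 ys3. \<lbrakk>distinct (a # ys1 @ [b]); distinct (a # ys2 @ [b]); distinct (a # ys3 @ [b]);
          walk_edges (a # ys1 @ [b]) \<subseteq> E; walk_edges (a # ys2 @ [b]) \<subseteq> E; walk_edges (a # ys3 @ [b]) \<subseteq> E;
          ys1 \<noteq> []; ys2 \<noteq> []; ys3 \<noteq> []; set ys1 \<inter> set ys2 = {}; set ys1 \<inter> set ys3 = {}; set ys2 \<inter> set ys3 = {}\<rbrakk> \<Longrightarrow> False"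
    and no_crossing: "\<And>a A1 c A2 b A3 d A4. cycle_in E (a # A1 @ c # A2 @ b # A3 @ d # A4) \<Longrightarrow>
          {a, b} \<in> E \<Longrightarrow> {c, d} \<in> E \<Longrightarrow> False"
  shows "\<exists>pos. noncrossing W E pos"
  using \<open>finite W\<close>
proof (induction W rule: finite_psubset_induct)
  case (psubset W)
  show ?case
  proof (cases "\<exists>A B x. A \<union> B = W \<and> A \<noteq> W \<and> B \<noteq> W \<and> A \<inter> B \<subseteq> {x} \<and> (\<forall>e\<in>E. e \<subseteq> W \<longrightarrow> e \<subseteq> A \<or> e \<subseteq> B)")
    case True
    then obtain A B x where *: "A \<union> B = W \<and> A \<noteq> W \<and> B \<noteq> W \<and> A \<inter> B \<subseteq> {x} \<and>
        (\<forall>e\<in>E. e \<subseteq> W \<longrightarrow> e \<subseteq> A \<or> e \<subseteq> B)"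
      by (elim exE)
    then have AB: "A \<union> B = W" "A \<noteq> W" "B \<noteq> W" "A \<inter> B \<subseteq> {x}"
      and split: "\<And>e. e \<in> E \<Longrightarrow> e \<subseteq> A \<union> B \<Longrightarrow> e \<subseteq> A \<or> e \<subseteq> B"
      by simp_all
    have "A \<subset> W" "B \<subset> W" using AB by auto
    obtain posA where A: "noncrossing A E posA" using psubset.IH[OF \<open>A \<subset> W\<close>] by blast
    obtain posB where B: "noncrossing B E posB" using psubset.IH[OF \<open>B \<subset> W\<close>] by blast
    have "finite A" "finite B" using AB psubset.hyps by auto
    then show ?thesis
      using noncrossing_glue[OF A B _ _ split AB(4)] AB(1) by metis
  next
    case insep: False
    show ?thesis
    proof (cases "\<exists>e\<in>E. e \<subseteq> W")
      case True
      then obtain u v where uv: "{u, v} \<in> E" "{u, v} \<subseteq> W" "u \<noteq> v"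
        using E by (metis card_2_iff)
      define C where "C = {zs. cycle_in E zs \<and> set zs \<subseteq> W}"
      have "[u, v] \<in> C" using uv by (auto simp: C_def cycle_in_def insert_commute)
      moreover have "length zs \<le> card W" if "zs \<in> C" for zs
        using that psubset.hyps card_mono[of W "set zs"] by (auto simp: C_def cycle_in_def distinct_card)
      ultimately have "\<exists>xs. xs \<in> C \<and> (\<forall>zs. zs \<in> C \<longrightarrow> length zs \<le> length xs)"
        by (intro ex_has_greatest_nat[where k = "[u, v]" and b = "Suc (card W)"]) (auto simp: less_Suc_eq_le)
      then obtain xs where xs: "xs \<in> C" "\<And>zs. zs \<in> C \<Longrightarrow> length zs \<le> length xs"
        by auto
      have "set xs = W"
      proof (rule longest_cycle_spans, fact, fact E, fact no_theta)
        fix A B x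
        assume "A \<union> B = W" "A \<noteq> W" "B \<noteq> W" "A \<inter> B \<subseteq> {x}" "\<And>e. e \<in> E \<Longrightarrow> e \<subseteq> W \<Longrightarrow> e \<subseteq> A \<or> e \<subseteq> B"
        then have "A \<union> B = W \<and> A \<noteq> W \<and> B \<noteq> W \<and> A \<inter> B \<subseteq> {x} \<and> (\<forall>e\<in>E. e \<subseteq> W \<longrightarrow> e \<subseteq> A \<or> e \<subseteq> B)"
          by simp
        with insep show False by metis
      qed (use xs in \<open>simp_all add: C_def\<close>)
      moreover have "cycle_in E xs" using xs(1) by (simp add: C_def)
      ultimately show ?thesis
        using noncrossing_cycle[of E xs] no_crossing by metis
    next
      case False
      \<comment> \<open>Without edges any vertex can be split off, so an inseparable W has at most
        one vertex.\<close>
      have "W \<subseteq> {w}" if "w \<in> W" for w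
      proof (rule ccontr)
        assume "\<not> W \<subseteq> {w}"
        then have "{w} \<union> (W - {w}) = W \<and> {w} \<noteq> W \<and> W - {w} \<noteq> W \<and> {w} \<inter> (W - {w}) \<subseteq> {w} \<and>
            (\<forall>e\<in>E. e \<subseteq> W \<longrightarrow> e \<subseteq> {w} \<or> e \<subseteq> W - {w})"
          using that False by blast
        with insep show False by metis
      qed
      then have "a = b" if "a \<in> W" "b \<in> W" for a b
        using that by blast
      then have "noncrossing W E (\<lambda>_. 0)"
        by (auto simp: noncrossing_def inj_on_def)
      then show ?thesis by blast
    qed
  qed
qed

subsection \<open>Theta curves\<close>

text \<open>The complement of T is the disjoint union of the open sets \<open>inside T\<close> and
  \<open>outside T\<close>.\<close>

lemma connected_inside_or_outside:
  fixes S T :: "complex set"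
  assumes "connected S" "closed T" "S \<inter> T = {}"
  shows "S \<subseteq> inside T \<or> S \<subseteq> outside T"
proof (rule ccontr)
  assume "\<not> ?thesis"
  moreover have "S \<subseteq> inside T \<union> outside T"
    using assms(3) by auto
  ultimately have "inside T \<inter> S \<noteq> {}" "outside T \<inter> S \<noteq> {}"
    by blast+
  then show False
    using connectedD[OF \<open>connected S\<close> open_inside open_outside] \<open>S \<subseteq> inside T \<union> outside T\<close> assms(2)
      inside_Int_outside[of T] by blast
qed

text \<open>The conditions are symmetric in the three arcs. Facts are proved for one choice of arcs
  and transferred to the others by interpreting the locale with the arcs permuted.\<close>

locale theta_curve =
  fixes c1 c2 c3 :: "real \<Rightarrow> complex" and a b :: complex
  assumes arc: "arc c1" "arc c2" "arc c3"
    and start: "pathstart c1 = a" "pathstart c2 = a" "pathstart c3 = a"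
    and finish: "pathfinish c1 = b" "pathfinish c2 = b" "pathfinish c3 = b"
    and Int: "path_image c1 \<inter> path_image c2 = {a, b}" "path_image c1 \<inter> path_image c3 = {a, b}"
      "path_image c2 \<inter> path_image c3 = {a, b}"
begin

lemma ends_neq: "a \<noteq> b"
  using arc_distinct_ends[OF arc(1)] start finish by simp

lemma Jordan12:
  defines "J \<equiv> path_image c1 \<union> path_image c2"
  shows "compact J" "inside J \<noteq> {}" "connected (inside J)" "connected (outside J)" "frontier (inside J) = J"
proof -
  let ?c = "c1 +++ reversepath c2"
  have im: "path_image ?c = J"
    using finish by (simp add: path_image_join J_def)
  have "simple_path ?c"
    using arc start finish Int by (simp add: simple_path_join_loop_eq arc_reversepath)
  moreover have "pathfinish ?c = pathstart ?c"
    using start by simp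
  ultimately show "inside J \<noteq> {}" "connected (inside J)" "connected (outside J)" "frontier (inside J) = J"
    using Jordan_inside_outside[of ?c] unfolding im by blast+
  show "compact J"
    using arc by (simp add: J_def compact_Un compact_arc_image)
qed

lemma open_arc:
  "connected (path_image c1 - {a, b})" "path_image c1 - {a, b} \<noteq> {}"
  "(path_image c1 - {a, b}) \<inter> (path_image c2 \<union> path_image c3) = {}"
  using connected_simple_path_endless[of c1] nonempty_simple_path_endless[of c1] arc start finish Int
  by (auto simp: arc_imp_simple_path)

text \<open>The connected region inside the second and third arcs avoids the curve of the first two,
  so it lies on one side of it. If it were inside, the converse inclusion would follow in the same
  way. Equal insides have equal frontiers, so the two Jordan curves would coincide, although the
  open first arc lies on only one of them.\<close>

lemma inside_subset_outside:
  assumes 1: "path_image c1 - {a, b} \<subseteq> outside (path_image c2 \<union> path_image c3)"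
    and 3: "path_image c3 - {a, b} \<subseteq> outside (path_image c1 \<union> path_image c2)"
  shows "inside (path_image c2 \<union> path_image c3) \<subseteq> outside (path_image c1 \<union> path_image c2)"
proof -
  let ?S = "path_image c1 \<union> path_image c2" and ?T = "path_image c2 \<union> path_image c3"
  interpret p: theta_curve c2 c3 c1 a b
    using arc start finish Int by unfold_locales auto
  have ab: "a \<in> path_image c2" "b \<in> path_image c2"
    using Int by blast+
  have T: "inside ?T \<inter> ?S = {}"
  proof -
    have "inside ?T \<inter> (path_image c1 - {a, b}) = {}"
      using 1 inside_Int_outside[of ?T] by blast
    moreover have "inside ?T \<inter> path_image c2 = {}"
      using inside_no_overlap[of ?T] by blast
    ultimately show ?thesis using ab by blast
  qed
  have S: "inside ?S \<inter> ?T = {}"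
  proof -
    have "inside ?S \<inter> (path_image c3 - {a, b}) = {}"
      using 3 inside_Int_outside[of ?S] by blast
    moreover have "inside ?S \<inter> path_image c2 = {}"
      using inside_no_overlap[of ?S] by blast
    ultimately show ?thesis using ab by blast
  qed
  have "\<not> inside ?T \<subseteq> inside ?S"
  proof
    assume TS: "inside ?T \<subseteq> inside ?S"
    then have "inside ?S \<inter> inside ?T \<noteq> {}"
      using p.Jordan12(2) by blast
    then have "inside ?S \<subseteq> inside ?T"
      using connected_inside_or_outside[OF Jordan12(3) compact_imp_closed[OF p.Jordan12(1)] S]
        inside_Int_outside[of ?T] by blast
    then have "?S = ?T"
      using TS Jordan12(5) p.Jordan12(5) by (metis subset_antisym)
    then have "(path_image c1 - {a, b}) \<inter> ?T = path_image c1 - {a, b}"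
      by blast
    then show False using open_arc by simp
  qed
  then show ?thesis
    using connected_inside_or_outside[OF p.Jordan12(3) compact_imp_closed[OF Jordan12(1)] T] by blast
qed

text \<open>
  If no arc were inside the Jordan curve of the other two, then a point inside the curve of two
  arcs would be outside the other two curves, and these share a connected set, the third arc. By
  Janiszewski's theorem it could then be joined to infinity off the whole theta curve.
\<close>

theorem one_arc_inside:
  "path_image c1 - {a, b} \<subseteq> inside (path_image c2 \<union> path_image c3) \<or>
   path_image c2 - {a, b} \<subseteq> inside (path_image c1 \<union> path_image c3) \<or>
   path_image c3 - {a, b} \<subseteq> inside (path_image c1 \<union> path_image c2)"
proof (rule ccontr)
  assume contra: "\<not> ?thesis"
  interpret p2: theta_curve c2 c3 c1 a b
    using arc start finish Int by unfold_locales auto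
  interpret p3: theta_curve c3 c1 c2 a b
    using arc start finish Int by unfold_locales auto
  interpret p4: theta_curve c1 c3 c2 a b
    using arc start finish Int by unfold_locales auto
  let ?S = "path_image c1 \<union> path_image c2" and ?T = "path_image c1 \<union> path_image c3"
    and ?U = "path_image c2 \<union> path_image c3"
  have out1: "path_image c1 - {a, b} \<subseteq> outside ?U"
    using connected_inside_or_outside[OF open_arc(1) compact_imp_closed[OF p2.Jordan12(1)] open_arc(3)] contra
    by blast
  have out2: "path_image c2 - {a, b} \<subseteq> outside ?T"
    using connected_inside_or_outside[OF p2.open_arc(1) compact_imp_closed[OF p3.Jordan12(1)] p2.open_arc(3)] contra
    by (simp add: Un_commute)
  have out3: "path_image c3 - {a, b} \<subseteq> outside ?S"
    using connected_inside_or_outside[OF p3.open_arc(1) compact_imp_closed[OF Jordan12(1)] p3.open_arc(3)] contra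
    by (simp add: Un_commute)
  have US: "inside ?U \<subseteq> outside ?S"
    using inside_subset_outside out1 out3 by blast
  have UT: "inside ?U \<subseteq> outside ?T"
    using p4.inside_subset_outside out1 out2 by (simp add: Un_commute)
  obtain x where x: "x \<in> inside ?U" using p2.Jordan12(2) by blast
  have "bounded (?S \<union> ?T \<union> ?U)"
    using arc by (simp add: compact_imp_bounded compact_arc_image)
  then have "outside (?S \<union> ?T \<union> ?U) \<noteq> {}"
    using unbounded_outside bounded_empty by metis
  then obtain y where "y \<in> outside (?S \<union> ?T \<union> ?U)" by blast
  then have y: "y \<in> outside ?S" "y \<in> outside ?T" "y \<in> outside ?U"
    using outside_mono[of _ "?S \<union> ?T \<union> ?U"] by blast+
  have "connected_component (- (?S \<union> ?T)) x y"
  proof (rule Janiszewski)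
    show "compact ?S" "closed ?T"
      using Jordan12(1) p4.Jordan12(1) by (simp_all add: compact_imp_closed)
    have "?S \<inter> ?T = path_image c1"
      using Int by blast
    then show "connected (?S \<inter> ?T)"
      using arc by (simp add: connected_arc_image)
    show "connected_component (- ?S) x y"
      unfolding connected_component_def
      using x y(1) US Jordan12(4) outside_no_overlap[of ?S] by (intro exI[of _ "outside ?S"]) blast
    show "connected_component (- ?T) x y"
      unfolding connected_component_def
      using x y(2) UT p4.Jordan12(4) outside_no_overlap[of ?T] by (intro exI[of _ "outside ?T"]) blast
  qed
  then have "connected_component (- ?U) x y"
    by (rule connected_component_mono[THEN subsetD, simplified, rotated]) auto
  then have "y \<in> inside ?U"
    using inside_same_component x by blast
  then show False using y(3) inside_Int_outside[of ?U] by blast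
qed

end

text \<open>Transfers information from an edge without its ends to these ends: if the open arc lies
  in a region, the end vertices lie in its closure.\<close>

lemma closure_open_arc:
  assumes "arc g"
  shows "path_image g \<subseteq> closure (path_image g - {pathstart g, pathfinish g})"
proof -
  let ?I = "{0<..<1::real}"
  have "g ` closure ?I \<subseteq> closure (path_image g - {pathstart g, pathfinish g})"
  proof (rule image_closure_subset)
    show "continuous_on (closure ?I) g"
      using assms by (simp add: arc_def path_def)
    have "g t \<noteq> g 0" "g t \<noteq> g 1" if "t \<in> ?I" for t
      using assms that inj_onD[of g "{0..1}" t 0] inj_onD[of g "{0..1}" t 1] by (auto simp: arc_def)
    then have "g ` ?I \<subseteq> path_image g - {pathstart g, pathfinish g}"
      by (auto simp: path_image_def pathstart_def pathfinish_def)
    then show "g ` ?I \<subseteq> closure (path_image g - {pathstart g, pathfinish g})"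
      using closure_subset by blast
  qed auto
  then show ?thesis by (simp add: path_image_def)
qed

subsection \<open>Outerplanar drawings\<close>

locale outerplanar_drawing =
  fixes V :: "'a set" and E :: "'a set set" and p :: "'a \<Rightarrow> complex" and c :: "'a set \<Rightarrow> real \<Rightarrow> complex"
  assumes graph: "finite_graph V E"
    and drawing: "plane_drawing V E p c"
    and outer: "p ` V \<subseteq> frontier (outside (drawing_points V E p c))"
begin

definition trace :: "'a set set \<Rightarrow> complex set" where
  "trace F = (\<Union>e\<in>F. path_image (c e))"

lemma edge: "e \<in> E \<Longrightarrow> e \<subseteq> V" "e \<in> E \<Longrightarrow> card e = 2"
  using graph by (auto simp: finite_graph_def)

lemma finite_E: "finite E"
proof (rule finite_subset)
  show "E \<subseteq> Pow V" using edge(1) by blast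
  show "finite (Pow V)" using graph by (simp add: finite_graph_def)
qed

lemma inj_p: "inj_on p V"
  using drawing by (simp add: plane_drawing_def)

lemma edge_arc:
  assumes "e \<in> E"
  shows "arc (c e)" "{pathstart (c e), pathfinish (c e)} = p ` e" "path_image (c e) \<inter> p ` V = p ` e"
  using drawing assms by (simp_all add: plane_drawing_def)

lemma trace_Un: "trace (F \<union> G) = trace F \<union> trace G"
  by (auto simp: trace_def)

lemma compact_trace: "F \<subseteq> E \<Longrightarrow> compact (trace F)"
  unfolding trace_def
  using finite_subset[OF _ finite_E] edge_arc(1) by (intro compact_UN compact_arc_image) blast+

lemma vertices_trace:
  assumes "F \<subseteq> E"
  shows "trace F \<inter> p ` V = p ` \<Union>F"
proof -
  have "trace F \<inter> p ` V = (\<Union>e\<in>F. path_image (c e) \<inter> p ` V)"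
    by (auto simp: trace_def)
  also have "\<dots> = (\<Union>e\<in>F. p ` e)"
    by (rule SUP_cong) (use assms edge_arc(3) in blast)+
  finally show ?thesis by blast
qed

lemma vertex_in_trace_iff:
  assumes "F \<subseteq> E" "v \<in> V"
  shows "p v \<in> trace F \<longleftrightarrow> v \<in> \<Union>F"
proof -
  have "\<Union>F \<subseteq> V" using assms(1) edge(1) by blast
  then have "p v \<in> p ` \<Union>F \<longleftrightarrow> v \<in> \<Union>F"
    using inj_p assms(2) by (meson inj_on_image_mem_iff)
  then show ?thesis
    using vertices_trace[OF assms(1)] assms(2) by blast
qed

lemma trace_Int:
  assumes "F \<subseteq> E" "G \<subseteq> E" "F \<inter> G = {}"
  shows "trace F \<inter> trace G = p ` (\<Union>F \<inter> \<Union>G)"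
proof
  have "path_image (c e) \<inter> path_image (c f) \<subseteq> p ` (\<Union>F \<inter> \<Union>G)" if "e \<in> F" "f \<in> G" for e f
  proof -
    have "e \<in> E" "f \<in> E" "e \<noteq> f" using that assms by auto
    then have "path_image (c e) \<inter> path_image (c f) \<subseteq> p ` (e \<inter> f)"
      using drawing by (simp add: plane_drawing_def)
    then show ?thesis using that by blast
  qed
  then show "trace F \<inter> trace G \<subseteq> p ` (\<Union>F \<inter> \<Union>G)"
    unfolding trace_def by blast
  show "p ` (\<Union>F \<inter> \<Union>G) \<subseteq> trace F \<inter> trace G"
    using vertices_trace[OF assms(1)] vertices_trace[OF assms(2)] by blast
qed

text \<open>This is where outerplanarity enters. The outer face of the whole drawing is disjoint
  from the open set \<open>inside (trace F)\<close>, whereas every vertex lies in the closure of the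
  outer face.\<close>

lemma not_inside_trace:
  assumes "F \<subseteq> E" "v \<in> V"
  shows "p v \<notin> inside (trace F)"
proof
  assume v: "p v \<in> inside (trace F)"
  have "trace F \<subseteq> drawing_points V E p c"
    using assms by (auto simp: trace_def drawing_points_def)
  then have "outside (drawing_points V E p c) \<inter> inside (trace F) = {}"
    using outside_mono inside_Int_outside[of "trace F"] by blast
  moreover have "open (inside (trace F))"
    using compact_trace[OF assms(1)] by (simp add: open_inside compact_imp_closed)
  moreover have "p v \<in> closure (outside (drawing_points V E p c))"
    using outer assms(2) by (auto simp: frontier_def)
  ultimately show False
    using v by (metis Int_commute IntI empty_iff open_Int_closure_eq_empty)
qed

text \<open>The drawing does not fix the direction of an edge, so its arc is reversed where
  necessary.\<close>

lemma edge_path: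
  assumes "{x, y} \<in> E"
  obtains g where "arc g" "pathstart g = p x" "pathfinish g = p y" "path_image g = path_image (c {x, y})"
proof -
  let ?g = "c {x, y}"
  consider "pathstart ?g = p x" "pathfinish ?g = p y" | "pathstart ?g = p y" "pathfinish ?g = p x"
    using edge_arc(2)[OF assms] unfolding image_insert image_empty doubleton_eq_iff by blast
  then show thesis
  proof cases
    case 1
    then show thesis using that[of ?g] edge_arc(1)[OF assms] by simp
  next
    case 2
    then show thesis using that[of "reversepath ?g"] edge_arc(1)[OF assms] by (simp add: arc_reversepath)
  qed
qed

lemma walk_path:
  assumes "walk_edges xs \<subseteq> E" "distinct xs" "length xs \<ge> 2"
  obtains g where "arc g" "pathstart g = p (hd xs)" "pathfinish g = p (last xs)"
    "path_image g = trace (walk_edges xs)"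
proof -
  have "\<exists>g. arc g \<and> pathstart g = p (hd xs) \<and> pathfinish g = p (last xs) \<and> path_image g = trace (walk_edges xs)"
    using assms
  proof (induction xs rule: walk_edges.induct)
    case (1 x y zs)
    have xy: "{x, y} \<in> E" using 1(2) by simp
    have tr: "trace {{x, y}} = path_image (c {x, y})" by (simp add: trace_def)
    obtain g1 where g1: "arc g1" "pathstart g1 = p x" "pathfinish g1 = p y" "path_image g1 = trace {{x, y}}"
      unfolding tr by (rule edge_path[OF xy])
    show ?case
    proof (cases "zs = []")
      case True
      then show ?thesis using g1 by (intro exI[of _ g1]) simp
    next
      case False
      let ?F = "walk_edges (y # zs)"
      have F: "?F \<subseteq> E" "{{x, y}} \<subseteq> E" using 1(2) by auto
      have len: "length (y # zs) \<ge> 2" using False by (cases zs) auto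
      obtain g2 where g2: "arc g2" "pathstart g2 = p y" "pathfinish g2 = p (last (y # zs))" "path_image g2 = trace ?F"
        using 1(1)[OF F(1) _ len] 1(3) by auto
      have UF: "\<Union>?F = set (y # zs)"
        using Union_walk_edges[OF len] .
      moreover have "x \<notin> set (y # zs)" using 1(3) by simp
      ultimately have "{{x, y}} \<inter> ?F = {}" by blast
      then have "trace {{x, y}} \<inter> trace ?F = p ` ({x, y} \<inter> set (y # zs))"
        using trace_Int[OF F(2,1)] UF by simp
      also have "\<dots> = {p y}" using 1(3) by auto
      finally have "arc (g1 +++ g2)" "path_image (g1 +++ g2) = trace (walk_edges (x # y # zs))"
        using g1 g2 by (auto simp: arc_join_eq path_image_join trace_def)
      then show ?thesis using g1 g2 by (intro exI[of _ "g1 +++ g2"]) simp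
    qed
  qed auto
  then show thesis using that by blast
qed

text \<open>Only one of the two walks is required to have interior vertices, so the other may be a
  chord from a to b.\<close>

lemma walk_Int:
  assumes "walk_edges (a # ys @ [b]) \<subseteq> E" "walk_edges (a # zs @ [b]) \<subseteq> E"
    and "set ys \<inter> set zs = {}" "a \<notin> set ys" "b \<notin> set ys" "ys \<noteq> []"
  shows "trace (walk_edges (a # ys @ [b])) \<inter> trace (walk_edges (a # zs @ [b])) = {p a, p b}"
proof -
  have "walk_edges (a # ys @ [b]) \<inter> walk_edges (a # zs @ [b]) = {}"
  proof (rule ccontr)
    assume "\<not> ?thesis"
    then obtain e where "e \<in> walk_edges (a # ys @ [b])" "e \<in> walk_edges (a # zs @ [b])" by blast
    then have "e \<inter> set ys \<noteq> {}" "e \<subseteq> set (a # zs @ [b])"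
      using walk_edges_meet_interior \<open>ys \<noteq> []\<close> walk_edge_subset by metis+
    then show False using assms(3-5) by auto
  qed
  moreover have "\<Union>(walk_edges (a # ys @ [b])) \<inter> \<Union>(walk_edges (a # zs @ [b])) = {a, b}"
    using assms by (subst (1 2) Union_walk_edges) auto
  ultimately show ?thesis
    using trace_Int[OF assms(1,2)] by simp
qed

text \<open>One of the three arcs is inside the curve of the other two, and it cannot be one that
  carries an interior vertex. This leaves the third, for which ys3 may be empty: a chord of a cycle
  is drawn inside it.\<close>

lemma theta_paths:
  assumes dist: "distinct (a # ys1 @ [b])" "distinct (a # ys2 @ [b])" "distinct (a # ys3 @ [b])"
    and walk: "walk_edges (a # ys1 @ [b]) \<subseteq> E" "walk_edges (a # ys2 @ [b]) \<subseteq> E" "walk_edges (a # ys3 @ [b]) \<subseteq> E"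
    and disj: "set ys1 \<inter> set ys2 = {}" "set ys1 \<inter> set ys3 = {}" "set ys2 \<inter> set ys3 = {}"
    and ne: "ys1 \<noteq> []" "ys2 \<noteq> []"
  obtains g1 g2 g3 where "theta_curve g1 g2 g3 (p a) (p b)"
    "path_image g1 = trace (walk_edges (a # ys1 @ [b]))"
    "path_image g2 = trace (walk_edges (a # ys2 @ [b]))"
    "path_image g3 = trace (walk_edges (a # ys3 @ [b]))"
    "path_image g3 - {p a, p b} \<subseteq> inside (path_image g1 \<union> path_image g2)"
proof -
  let ?W = "\<lambda>ys. walk_edges (a # ys @ [b])"
  have arc: "\<exists>g. arc g \<and> pathstart g = p a \<and> pathfinish g = p b \<and> path_image g = trace (?W ys)"
    if "distinct (a # ys @ [b])" "?W ys \<subseteq> E" for ys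
    by (rule walk_path[OF that(2,1)]) auto
  obtain g1 where g1: "arc g1" "pathstart g1 = p a" "pathfinish g1 = p b" "path_image g1 = trace (?W ys1)"
    using arc dist walk by blast
  obtain g2 where g2: "arc g2" "pathstart g2 = p a" "pathfinish g2 = p b" "path_image g2 = trace (?W ys2)"
    using arc dist walk by blast
  obtain g3 where g3: "arc g3" "pathstart g3 = p a" "pathfinish g3 = p b" "path_image g3 = trace (?W ys3)"
    using arc dist walk by blast
  interpret theta_curve g1 g2 g3 "p a" "p b"
  proof
    show "path_image g1 \<inter> path_image g2 = {p a, p b}"
      using walk_Int[OF walk(1,2) disj(1)] g1 g2 dist ne by simp
    show "path_image g1 \<inter> path_image g3 = {p a, p b}"
      using walk_Int[OF walk(1,3) disj(2)] g1 g3 dist ne by simp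
    show "path_image g2 \<inter> path_image g3 = {p a, p b}"
      using walk_Int[OF walk(2,3) disj(3)] g2 g3 dist ne by simp
  qed (simp_all add: g1 g2 g3)
  have not_inside: "\<not> trace (?W ys) - {p a, p b} \<subseteq> inside (trace F)"
    if y: "ys \<noteq> []" "distinct (a # ys @ [b])" "?W ys \<subseteq> E" and F: "F \<subseteq> E" for ys F
  proof
    assume sub: "trace (?W ys) - {p a, p b} \<subseteq> inside (trace F)"
    obtain v where v: "v \<in> set ys" using y(1) by (cases ys) auto
    have U: "\<Union>(?W ys) = set (a # ys @ [b])"
      by (rule Union_walk_edges) simp
    then have V: "set (a # ys @ [b]) \<subseteq> V" using y(3) edge(1) by blast
    then have "p v \<in> trace (?W ys)"
      using vertex_in_trace_iff[OF y(3), of v] U v by auto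
    moreover have "p v \<noteq> p a" "p v \<noteq> p b"
      using V v y(2) inj_onD[OF inj_p, of v a] inj_onD[OF inj_p, of v b] by auto
    ultimately have "p v \<in> inside (trace F)" using sub by blast
    then show False using not_inside_trace[OF F, of v] v V by auto
  qed
  have "path_image g3 - {p a, p b} \<subseteq> inside (path_image g1 \<union> path_image g2)"
    using one_arc_inside not_inside[of ys1 "?W ys2 \<union> ?W ys3"] not_inside[of ys2 "?W ys1 \<union> ?W ys3"] 
      dist walk ne g1 g2 g3 by (auto simp: trace_Un)
  with that theta_curve_axioms g1 g2 g3 show thesis by blast
qed

text \<open>By \<open>theta_paths\<close> the third arc is inside the curve of the other two, but
  here it carries a vertex as well.\<close>

lemma no_three_paths:
  assumes "distinct (a # ys1 @ [b])" "distinct (a # ys2 @ [b])" "distinct (a # ys3 @ [b])"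
    and "walk_edges (a # ys1 @ [b]) \<subseteq> E" "walk_edges (a # ys2 @ [b]) \<subseteq> E" "walk_edges (a # ys3 @ [b]) \<subseteq> E"
    and "ys1 \<noteq> []" "ys2 \<noteq> []" "ys3 \<noteq> []"
    and "set ys1 \<inter> set ys2 = {}" "set ys1 \<inter> set ys3 = {}" "set ys2 \<inter> set ys3 = {}"
  shows False
proof -
  let ?W = "\<lambda>ys. walk_edges (a # ys @ [b])"
  obtain v where v: "v \<in> set ys3" using \<open>ys3 \<noteq> []\<close> by (cases ys3) auto
  have U: "\<Union>(?W ys3) = set (a # ys3 @ [b])"
    by (rule Union_walk_edges) simp
  then have V: "set (a # ys3 @ [b]) \<subseteq> V" using assms(6) edge(1) by blast
  have "p v \<in> trace (?W ys3)"
    using vertex_in_trace_iff[OF assms(6), of v] U V v by auto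
  moreover have "p v \<noteq> p a" "p v \<noteq> p b"
    using V v assms(3) inj_onD[OF inj_p, of v a] inj_onD[OF inj_p, of v b] by auto
  moreover have "trace (?W ys3) - {p a, p b} \<subseteq> inside (trace (?W ys1 \<union> ?W ys2))"
    using theta_paths[OF assms(1-6) assms(10-12) assms(7,8)] by (metis trace_Un)
  moreover have "p v \<notin> inside (trace (?W ys1 \<union> ?W ys2))"
    by (rule not_inside_trace) (use assms(4,5) v V in \<open>simp_all add: subset_iff\<close>)
  ultimately show False by blast
qed

text \<open>Both chords are inside the cycle. The chord from a to b cuts the inside into two
  regions, and the other chord, being disjoint from it, stays in one of them. Then c' and d both lie
  in the closure of this region, but each region has one of them neither inside nor on its
  boundary.\<close>

lemma no_crossing_chords:
  assumes cyc: "cycle_in E (a # A1 @ c' # A2 @ b # A3 @ d # A4)"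
    and ab: "{a, b} \<in> E" and cd: "{c', d} \<in> E"
  shows False
proof -
  \<comment> \<open>The four vertices cut the cycle into these quarters.\<close>
  let ?Q1 = "walk_edges (a # A1 @ [c'])" and ?Q2 = "walk_edges (c' # A2 @ [b])"
    and ?Q3 = "walk_edges (b # A3 @ [d])" and ?Q4 = "walk_edges (d # A4 @ [a])"
  have dist: "distinct (a # A1 @ c' # A2 @ b # A3 @ d # A4)"
    using cyc by (simp add: cycle_in_def)
  have "walk_edges ((a # A1 @ c' # A2 @ b # A3 @ d # A4) @ [a]) = ?Q1 \<union> ?Q2 \<union> ?Q3 \<union> ?Q4"
    using walk_edges_append[of "a # A1" c' "A2 @ b # A3 @ d # A4 @ [a]"]
      walk_edges_append[of "c' # A2" b "A3 @ d # A4 @ [a]"] walk_edges_append[of "b # A3" d "A4 @ [a]"]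
    by auto
  then have Q: "?Q1 \<subseteq> E" "?Q2 \<subseteq> E" "?Q3 \<subseteq> E" "?Q4 \<subseteq> E"
    using cyc by (auto simp: cycle_in_def)
  \<comment> \<open>Interiors of the two arcs of the cycle between a and b, and below between c' and
    d. The second arc is reversed each time so that both have the same start.\<close>
  let ?B1 = "A1 @ c' # A2" and ?B2 = "rev (A3 @ d # A4)"
  let ?C1 = "A2 @ b # A3" and ?C2 = "rev (A4 @ a # A1)"
  have B1: "walk_edges (a # ?B1 @ [b]) = ?Q1 \<union> ?Q2"
    using walk_edges_append[of "a # A1" c' "A2 @ [b]"] by simp
  have B2: "walk_edges (a # ?B2 @ [b]) = ?Q3 \<union> ?Q4"
    using walk_edges_append[of "b # A3" d "A4 @ [a]"] walk_edges_rev[of "b # (A3 @ d # A4) @ [a]"] by simp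
  have C1: "walk_edges (c' # ?C1 @ [d]) = ?Q2 \<union> ?Q3"
    using walk_edges_append[of "c' # A2" b "A3 @ [d]"] by simp
  have C2: "walk_edges (c' # ?C2 @ [d]) = ?Q4 \<union> ?Q1"
    using walk_edges_append[of "d # A4" a "A1 @ [c']"] walk_edges_rev[of "d # (A4 @ a # A1) @ [c']"] by simp
  let ?J = "?Q1 \<union> ?Q2 \<union> ?Q3 \<union> ?Q4"
  obtain g1 g2 g3 where th: "theta_curve g1 g2 g3 (p a) (p b)"
    and g: "path_image g1 = trace (?Q1 \<union> ?Q2)" "path_image g2 = trace (?Q3 \<union> ?Q4)" "path_image g3 = trace {{a, b}}"
    and ins: "path_image g3 - {p a, p b} \<subseteq> inside (path_image g1 \<union> path_image g2)"
    by (rule theta_paths[of a ?B1 b ?B2 "[]"]) (use dist Q ab B1 B2 in auto)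
  obtain h1 h2 h3 where th': "theta_curve h1 h2 h3 (p c') (p d)"
    and h: "path_image h1 = trace (?Q2 \<union> ?Q3)" "path_image h2 = trace (?Q4 \<union> ?Q1)" "path_image h3 = trace {{c', d}}"
    and ins': "path_image h3 - {p c', p d} \<subseteq> inside (path_image h1 \<union> path_image h2)"
    by (rule theta_paths[of c' ?C1 d ?C2 "[]"]) (use dist Q cd C1 C2 in auto)
  interpret g: theta_curve g1 g2 g3 "p a" "p b" by (fact th)
  \<comment> \<open>The chord is put first because \<open>open_arc\<close> speaks of the first
    arc.\<close>
  interpret h: theta_curve h3 h1 h2 "p c'" "p d"
    using th' by (auto simp: theta_curve_def)
  have J: "path_image g1 \<union> path_image g2 = trace ?J" "path_image h1 \<union> path_image h2 = trace ?J"
    by (auto simp: g h trace_Un)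
  have Vs: "a \<in> V" "b \<in> V" "c' \<in> V" "d \<in> V"
    using ab cd edge(1) by auto
  have neq: "a \<noteq> b" "a \<noteq> c'" "a \<noteq> d" "b \<noteq> c'" "b \<noteq> d" "c' \<noteq> d"
    using dist by auto
  let ?K = "path_image h3 - {p c', p d}"
  obtain eq: "inside (path_image g1 \<union> path_image g3) \<inter> inside (path_image g2 \<union> path_image g3) = {}"
      "inside (path_image g1 \<union> path_image g3) \<union> inside (path_image g2 \<union> path_image g3) \<union>
         (path_image g3 - {p a, p b}) = inside (path_image g1 \<union> path_image g2)"
  proof (rule split_inside_simple_closed_curve[of g1 "p a" "p b" g2 g3])
    show "path_image g3 \<inter> inside (path_image g1 \<union> path_image g2) \<noteq> {}"
      using ins nonempty_simple_path_endless[of g3] g.arc g.start g.finish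
      by (auto simp: arc_imp_simple_path)
  qed (use g.arc g.start g.finish g.Int g.ends_neq in \<open>auto simp: arc_imp_simple_path\<close>)
  let ?F1 = "insert {a, b} (?Q1 \<union> ?Q2)" and ?F2 = "insert {a, b} (?Q3 \<union> ?Q4)"
  have F: "?F1 \<subseteq> E" "?F2 \<subseteq> E" using Q ab by auto
  have F1: "path_image g1 \<union> path_image g3 = trace ?F1" and F2: "path_image g2 \<union> path_image g3 = trace ?F2"
    by (auto simp: g trace_def)
  have "path_image h3 \<inter> path_image g3 = p ` ({c', d} \<inter> {a, b})"
    using trace_Int[of "{{c', d}}" "{{a, b}}"] ab cd neq by (auto simp: g h doubleton_eq_iff)
  then have disj: "path_image h3 \<inter> path_image g3 = {}"
    using neq by auto
  then have K: "?K \<subseteq> inside (trace ?F1) \<union> inside (trace ?F2)"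
    using ins' eq(2) unfolding J F1 F2 by blast
  have "connected ?K" by (fact h.open_arc(1))
  moreover have "open (inside (trace ?F1))" "open (inside (trace ?F2))"
    using F by (simp_all add: open_inside compact_trace compact_imp_closed)
  ultimately have "?K \<subseteq> inside (trace ?F1) \<or> ?K \<subseteq> inside (trace ?F2)"
    using K eq(1) connectedD[of ?K "inside (trace ?F1)" "inside (trace ?F2)"] unfolding F1 F2 by blast
  \<comment> \<open>The end p v of the chord would lie in the closure of the inside, hence inside or
    on the boundary \<open>trace F\<close>. A vertex is never inside, and v is on no edge of
    F.\<close>
  moreover have no: "\<not> ?K \<subseteq> inside (trace F)"
    if "v \<in> {c', d}" "v \<notin> \<Union>F" "F \<subseteq> E" for v F
  proof
    assume "?K \<subseteq> inside (trace F)"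
    then have "closure ?K \<subseteq> closure (inside (trace F))"
      by (rule closure_mono)
    moreover have "p v \<in> path_image h3"
      using that(1) h.start h.finish pathstart_in_path_image[of h3] pathfinish_in_path_image[of h3] by auto
    ultimately have "p v \<in> closure (inside (trace F))"
      using closure_open_arc[of h3] h.arc h.start h.finish by auto
    moreover have "closure (inside (trace F)) \<subseteq> inside (trace F) \<union> trace F"
      using closure_inside_subset[OF compact_imp_closed[OF compact_trace[OF that(3)]]] by blast
    moreover have "p v \<notin> inside (trace F)" "p v \<notin> trace F"
      using not_inside_trace[OF that(3)] vertex_in_trace_iff[OF that(3)] that(1,2) Vs by auto
    ultimately show False by blast
  qed
  have "d \<notin> \<Union>?F1" "c' \<notin> \<Union>?F2"
    using dist walk_edge_subset[of _ "a # A1 @ [c']"] walk_edge_subset[of _ "c' # A2 @ [b]"]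
      walk_edge_subset[of _ "b # A3 @ [d]"] walk_edge_subset[of _ "d # A4 @ [a]"] by fastforce+
  ultimately show False
    using no[of d ?F1] no[of c' ?F2] F by blast
qed

lemma noncrossing_order: "\<exists>pos. noncrossing V E pos"
proof (rule noncrossing_exists, goal_cases)
  case 1
  show ?case using graph by (simp add: finite_graph_def)
next
  case (2 e)
  then show ?case by (rule edge(2))
next
  case (3 a b ys1 ys2 ys3)
  then show ?case by (rule no_three_paths)
next
  case (4 a A1 c' A2 b A3 d A4)
  then show ?case by (rule no_crossing_chords)
qed

end

subsection \<open>From touching strings to noncrossing orders\<close>

text \<open>Converts real abscissae, here those of grounding points, into natural positions by
  ranking.\<close>

lemma noncrossing_rank:
  fixes x :: "'a \<Rightarrow> real"
  assumes "finite V" "inj_on x V"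
    and nc: "\<And>a b c d. \<lbrakk>a \<in> V; b \<in> V; c \<in> V; d \<in> V; x a < x b; x b < x c; x c < x d;
      {a, c} \<in> E; {b, d} \<in> E\<rbrakk> \<Longrightarrow> False"
  shows "\<exists>pos. noncrossing V E pos"
proof -
  define pos where "pos v = card {u \<in> V. x u < x v}" for v
  have pos: "pos a < pos b \<longleftrightarrow> x a < x b" if "a \<in> V" "b \<in> V" for a b
  proof
    assume "x a < x b"
    then have "{u \<in> V. x u < x a} \<subset> {u \<in> V. x u < x b}"
      using that by (auto intro: order.strict_trans)
    then show "pos a < pos b"
      unfolding pos_def using \<open>finite V\<close> by (intro psubset_card_mono) auto
  next
    assume "pos a < pos b"
    show "x a < x b"
    proof (rule ccontr)
      assume "\<not> x a < x b"
      then have "{u \<in> V. x u < x b} \<subseteq> {u \<in> V. x u < x a}" by auto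
      then have "pos b \<le> pos a"
        unfolding pos_def using \<open>finite V\<close> by (intro card_mono) auto
      with \<open>pos a < pos b\<close> show False by simp
    qed
  qed
  have "inj_on pos V"
  proof (rule inj_onI)
    fix a b assume ab: "a \<in> V" "b \<in> V" "pos a = pos b"
    then have "x a = x b" using pos[of a b] pos[of b a] by linarith
    then show "a = b" using ab \<open>inj_on x V\<close> by (simp add: inj_onD)
  qed
  then have "noncrossing V E pos"
    using nc by (auto simp: noncrossing_def pos)
  then show ?thesis by blast
qed

text \<open>This is the Fashoda theorem for a box whose lower side is on the grounding line; \<phi>
  transports the curves to \<open>real^2\<close>.\<close>

lemma interlaced_paths_meet:
  fixes f g :: "real \<Rightarrow> complex"
  assumes fg: "path f" "path g"
    and above: "path_image f \<subseteq> {z. h \<le> Im z}" "path_image g \<subseteq> {z. h \<le> Im z}"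
    and ends: "Im (pathstart f) = h" "Im (pathfinish f) = h" "Im (pathstart g) = h" "Im (pathfinish g) = h"
    and order: "Re (pathstart f) < Re (pathstart g)" "Re (pathstart g) < Re (pathfinish f)"
      "Re (pathfinish f) < Re (pathfinish g)"
  shows "path_image f \<inter> path_image g \<noteq> {}"
proof -
  define \<phi> :: "complex \<Rightarrow> real^2" where "\<phi> z = vector [Re z, Im z]" for z
  have phi: "\<phi> z $ 1 = Re z" "\<phi> z $ 2 = Im z" for z
    by (simp_all add: \<phi>_def)
  have cont: "continuous_on S \<phi>" for S
  proof (rule linear_continuous_on)
    have "linear \<phi>" by (rule linearI) (simp_all add: vec_eq_iff forall_2 phi)
    then show "bounded_linear \<phi>" by (simp add: linear_conv_bounded_linear)
  qed
  have "bounded (path_image f \<union> path_image g)"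
    using fg by (simp add: bounded_path_image)
  then obtain M where M: "\<And>z. z \<in> path_image f \<union> path_image g \<Longrightarrow> cmod z \<le> M"
    by (auto simp: bounded_iff)
  \<comment> \<open>M bounds both curves, so they stay in the box with sides [-M, M] and
    [h, M].\<close>
  have box: "\<phi> ` path_image k \<subseteq> cbox (\<phi> (Complex (- M) h)) (\<phi> (Complex M M))"
    if "path_image k \<subseteq> path_image f \<union> path_image g" for k
  proof
    fix y assume "y \<in> \<phi> ` path_image k"
    then obtain z where "z \<in> path_image k" and z: "y = \<phi> z" by (rule imageE)
    have "z \<in> path_image f \<union> path_image g" using that \<open>z \<in> path_image k\<close> by (rule subsetD)
    then have "\<bar>Re z\<bar> \<le> M" "\<bar>Im z\<bar> \<le> M" "h \<le> Im z"
      using M[of z] abs_Re_le_cmod[of z] abs_Im_le_cmod[of z] above by auto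
    then show "y \<in> cbox (\<phi> (Complex (- M) h)) (\<phi> (Complex M M))"
      by (simp add: mem_box_cart forall_2 phi z abs_le_iff)
  qed
  have path: "path (\<phi> \<circ> k)" if "path k" for k
    using that cont by (intro path_continuous_image)
  obtain y where "y \<in> path_image (\<phi> \<circ> f)" "y \<in> path_image (\<phi> \<circ> g)"
  proof (rule fashoda_interlace[of "\<phi> \<circ> f" "\<phi> \<circ> g" "\<phi> (Complex (- M) h)" "\<phi> (Complex M M)"])
    show "path_image (\<phi> \<circ> f) \<subseteq> cbox (\<phi> (Complex (- M) h)) (\<phi> (Complex M M))"
      "path_image (\<phi> \<circ> g) \<subseteq> cbox (\<phi> (Complex (- M) h)) (\<phi> (Complex M M))"
      using box[of f] box[of g] by (simp_all add: path_image_compose)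
  qed (use path fg ends order in \<open>simp_all add: pathstart_compose pathfinish_compose phi\<close>)
  then obtain z z' where "z \<in> path_image f" "z' \<in> path_image g" "\<phi> z = \<phi> z'"
    by (auto simp: path_image_compose)
  moreover from this have "z = z'"
    by (metis complex_eqI phi)
  ultimately show ?thesis by blast
qed

section \<open>Thick strings and contacts of balls\<close>

lemma thick_string_iff: "q \<in> thick_string g r \<longleftrightarrow> (\<exists>z\<in>path_image g. dist z q \<le> r)"
  by (auto simp: thick_string_def)

definition open_string :: "(real \<Rightarrow> complex) \<Rightarrow> real \<Rightarrow> complex set" where
  "open_string g r = (\<Union>z\<in>path_image g. ball z r)"

lemma open_string_interior: "open_string g r \<subseteq> interior (thick_string g r)"
  by (rule interior_maximal) (auto simp: open_string_def thick_string_def)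

text \<open>A segment from a point of the thick string to a centre within distance r enters the open
  ball at once, so at most its starting point is off \<open>open_string\<close>. The curve g itself
  joins the two centres.\<close>

lemma thick_string_path:
  assumes "path g" "0 < r" "q \<in> thick_string g r" "q' \<in> thick_string g r"
  shows "path_component (open_string g r \<union> {q, q'}) q q'"
proof -
  let ?S = "open_string g r \<union> {q, q'}"
  obtain z z' where z: "z \<in> path_image g" "dist z q \<le> r" "z' \<in> path_image g" "dist z' q' \<le> r"
    using assms(3,4) by (auto simp: thick_string_iff)
  have seg: "path_component ?S y w" if "y \<in> {q, q'}" "w \<in> path_image g" "dist w y \<le> r" for y w
  proof (rule path_component_linepath)
    show "closed_segment y w \<subseteq> ?S"
    proof
      fix s assume "s \<in> closed_segment y w"
      then obtain u where u: "0 \<le> u" "u \<le> 1" "s = (1 - u) *\<^sub>R y + u *\<^sub>R w"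
        by (auto simp: closed_segment_def)
      show "s \<in> ?S"
      proof (cases "u = 0")
        case True
        then show ?thesis using u that(1) by auto
      next
        case False
        have "w - s = (1 - u) *\<^sub>R (w - y)" using u by (simp add: algebra_simps)
        then have "dist w s = (1 - u) * dist w y" using u by (simp add: dist_norm)
        also have "\<dots> \<le> (1 - u) * r" using u that by (intro mult_left_mono) auto
        also have "\<dots> < r" using False u \<open>0 < r\<close> by (simp add: algebra_simps)
        finally show ?thesis using that(2) by (auto simp: open_string_def)
      qed
    qed
  qed
  have "path_image g \<subseteq> ?S"
    using \<open>0 < r\<close> by (auto simp: open_string_def)
  moreover have "path_component (path_image g) z z'"
    using path_connected_path_image[OF \<open>path g\<close>] z by (simp add: path_connected_component)
  ultimately have "path_component ?S z z'"
    by (rule path_component_of_subset)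
  moreover have "path_component ?S q z" "path_component ?S q' z'"
    using seg[of q z] seg[of q' z'] z by simp_all
  ultimately show ?thesis
    by (blast intro: path_component_trans path_component_sym)
qed

lemma disjoint_balls_dist:
  fixes x y :: "'a::real_normed_vector"
  assumes "ball x r \<inter> ball y s = {}" "0 < r" "0 < s"
  shows "r + s \<le> dist x y"
proof (rule ccontr)
  assume "\<not> r + s \<le> dist x y"
  then have d: "dist x y < r + s" by simp
  \<comment> \<open>This point divides the segment from x to y in the ratio r : s, so it would lie
    in both balls.\<close>
  define q where "q = x + (r / (r + s)) *\<^sub>R (y - x)"
  have "y - q = (1 - r / (r + s)) *\<^sub>R (y - x)" by (simp add: q_def algebra_simps)
  moreover have "1 - r / (r + s) = s / (r + s)" using assms by (simp add: field_simps)
  ultimately have "dist y q = s / (r + s) * dist x y" "dist x q = r / (r + s) * dist x y"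
    using assms by (simp_all add: dist_norm q_def norm_minus_commute)
  moreover have "s / (r + s) * dist x y < s" "r / (r + s) * dist x y < r"
    using mult_strict_left_mono[OF d, of s] mult_strict_left_mono[OF d, of r] assms by (simp_all add: field_simps)
  ultimately have "q \<in> ball x r \<inter> ball y s" by simp
  then show False using assms by blast
qed

text \<open>
  The unit vectors from a common contact point to the three centres would have pairwise inner
  products at most \<open>-1\<close>, so that their sum would have negative squared length.
\<close>

lemma three_balls_no_common_contact:
  fixes w x y z :: "'a::real_inner"
  assumes pos: "0 < r" "0 < s" "0 < t"
    and w: "dist x w \<le> r" "dist y w \<le> s" "dist z w \<le> t"
    and xy: "r + s \<le> dist x y" and xz: "r + t \<le> dist x z" and yz: "s + t \<le> dist y z"
  shows False
proof -
  have ip: "((x - w) /\<^sub>R r) \<bullet> ((y - w) /\<^sub>R s) \<le> -1"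
    if "0 < r" "0 < s" "dist x w \<le> r" "dist y w \<le> s" "r + s \<le> dist x y" for x y :: 'a and r s :: real
  proof -
    have "(r + s)\<^sup>2 \<le> (dist x y)\<^sup>2" using that by (intro power_mono) auto
    also have "\<dots> = (x - w) \<bullet> (x - w) + (y - w) \<bullet> (y - w) - 2 * ((x - w) \<bullet> (y - w))"
      by (simp add: dist_norm power2_norm_eq_inner inner_diff inner_commute)
    also have "\<dots> \<le> r\<^sup>2 + s\<^sup>2 - 2 * ((x - w) \<bullet> (y - w))"
      using that by (simp add: dist_norm add_mono power_mono flip: power2_norm_eq_inner)
    finally have "(x - w) \<bullet> (y - w) \<le> - (r * s)"
      by (simp add: power2_sum)
    moreover have "((x - w) /\<^sub>R r) \<bullet> ((y - w) /\<^sub>R s) = ((x - w) \<bullet> (y - w)) / (r * s)"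
      by (simp add: divide_inverse mult.commute mult.left_commute)
    ultimately show ?thesis using that by (simp add: divide_le_eq)
  qed
  have unit: "((x - w) /\<^sub>R r) \<bullet> ((x - w) /\<^sub>R r) \<le> 1" if "0 < r" "dist x w \<le> r" for x :: 'a and r :: real
  proof -
    have "norm ((x - w) /\<^sub>R r) = dist x w / r"
      using that by (simp add: dist_norm divide_inverse mult.commute)
    then have "norm ((x - w) /\<^sub>R r) \<le> 1" using that by (simp add: divide_le_eq)
    then show ?thesis by (simp add: power_le_one flip: power2_norm_eq_inner)
  qed
  define a b c where "a = (x - w) /\<^sub>R r" and "b = (y - w) /\<^sub>R s" and "c = (z - w) /\<^sub>R t"
  have "a \<bullet> b \<le> -1" "a \<bullet> c \<le> -1" "b \<bullet> c \<le> -1" "a \<bullet> a \<le> 1" "b \<bullet> b \<le> 1" "c \<bullet> c \<le> 1"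
    using ip unit assms by (simp_all add: a_def b_def c_def)
  moreover have "0 \<le> (a + b + c) \<bullet> (a + b + c)" by simp
  ultimately show False by (simp add: inner_add inner_commute)
qed

theorem touching_grounded_strings_noncrossing:
  fixes \<gamma> :: "'a \<Rightarrow> real \<Rightarrow> complex"
  assumes "finite V" and tg: "touching_grounded_strings h V \<gamma>"
  shows "\<exists>pos. noncrossing V (intersection_edges V (\<lambda>v. path_image (\<gamma> v))) pos"
proof -
  let ?E = "intersection_edges V (\<lambda>v. path_image (\<gamma> v))"
  obtain g r where gr: "\<And>v. v \<in> V \<Longrightarrow> path (g v)" "\<And>v. v \<in> V \<Longrightarrow> 0 < r v"
    and gro: "grounded h V (\<lambda>v. thick_string (g v) (r v))"
    and fro: "\<And>u v. u \<in> V \<Longrightarrow> v \<in> V \<Longrightarrow> u \<noteq> v \<Longrightarrow> thick_string (g u) (r u) \<inter> thick_string (g v) (r v)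
             \<subseteq> frontier (thick_string (g u) (r u))"
    and meet: "\<And>u v. u \<in> V \<Longrightarrow> v \<in> V \<Longrightarrow> u \<noteq> v \<Longrightarrow> thick_string (g u) (r u) \<inter> thick_string (g v) (r v) \<noteq> {}
             \<longleftrightarrow> path_image (\<gamma> u) \<inter> path_image (\<gamma> v) \<noteq> {}"
  proof -
    have "touching h V \<gamma>" using tg by (simp add: touching_grounded_strings_def)
    \<comment> \<open>One perturbation is enough because it has the same adjacencies; the choice
      \<epsilon> = 1 is arbitrary.\<close>
    from this[unfolded touching_def, rule_format, OF zero_less_one] obtain g r where
      *: "\<forall>v\<in>V. path (g v) \<and> (\<forall>t\<in>{0..1}. dist (g v t) (\<gamma> v t) < 1) \<and> 0 < r v \<and> r v < 1"
        "grounded h V (\<lambda>v. thick_string (g v) (r v))"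
        "\<forall>u\<in>V. \<forall>v\<in>V. u \<noteq> v \<longrightarrow>
           thick_string (g u) (r u) \<inter> thick_string (g v) (r v)
             \<subseteq> frontier (thick_string (g u) (r u)) \<inter> frontier (thick_string (g v) (r v)) \<and>
           (thick_string (g u) (r u) \<inter> thick_string (g v) (r v) \<noteq> {}
             \<longleftrightarrow> path_image (\<gamma> u) \<inter> path_image (\<gamma> v) \<noteq> {})"
      by (elim exE conjE) blast
    show thesis by (rule that[of g r]) (use * in simp_all)
  qed
  define T where "T v = thick_string (g v) (r v)" for v
  define U where "U v = open_string (g v) (r v)" for v
  have UT: "U v \<subseteq> T v" for v
    using open_string_interior interior_subset unfolding U_def T_def by (metis subset_trans)
  \<comment> \<open>Contact in boundary points gives more than disjoint interiors: the open part of
    one string misses the whole of the other.\<close>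
  have UT_disjoint: "U u \<inter> T v = {}" if "u \<in> V" "v \<in> V" "u \<noteq> v" for u v
  proof -
    have "T u \<inter> T v \<subseteq> frontier (T u)" using fro[OF that] by (simp add: T_def)
    moreover have "U u \<subseteq> interior (T u)" using open_string_interior by (simp add: T_def U_def)
    ultimately show ?thesis using UT by (auto simp: frontier_def)
  qed
  have above: "T v \<subseteq> {z. h \<le> Im z}" if "v \<in> V" for v
    using gro that by (auto simp: grounded_def T_def)
  have "\<exists>q. q \<in> T v \<and> Im q = h" if "v \<in> V" for v
  proof -
    have "T v \<inter> {z. Im z = h} \<noteq> {}" using gro that unfolding grounded_def T_def by blast
    then show ?thesis by blast
  qed
  then obtain q where q: "\<And>v. v \<in> V \<Longrightarrow> q v \<in> T v" "\<And>v. v \<in> V \<Longrightarrow> Im (q v) = h"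
    by metis
  have qT: "q u \<notin> T v" if "u \<in> V" "v \<in> V" "u \<noteq> v" for u v
  proof
    assume "q u \<in> T v"
    then have "q u \<in> T u \<inter> T v \<inter> {z. Im z = h}" using q that by auto
    moreover have "T u \<inter> T v \<inter> {z. Im z = h} = {}" using gro that by (simp add: grounded_def T_def)
    ultimately show False by blast
  qed
  have no_triple: "w \<notin> T x" if w: "w \<in> T u" "w \<in> T v" and V: "u \<in> V" "v \<in> V" "x \<in> V"
    and neq: "u \<noteq> v" "u \<noteq> x" "v \<noteq> x" for u v x w
  proof
    assume "w \<in> T x"
    then obtain zu zv zx where z: "zu \<in> path_image (g u)" "zv \<in> path_image (g v)" "zx \<in> path_image (g x)"
      and d: "dist zu w \<le> r u" "dist zv w \<le> r v" "dist zx w \<le> r x"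
      using w by (auto simp: T_def thick_string_iff)
    have far: "r a + r b \<le> dist za zb"
      if "a \<in> V" "b \<in> V" "a \<noteq> b" "za \<in> path_image (g a)" "zb \<in> path_image (g b)" for a b za zb
    proof (rule disjoint_balls_dist)
      have "ball za (r a) \<subseteq> U a" "ball zb (r b) \<subseteq> T b"
        using that UT[of b] by (auto simp: U_def open_string_def)
      then show "ball za (r a) \<inter> ball zb (r b) = {}"
        using UT_disjoint[of a b] that by blast
    qed (use gr that in auto)
    show False
      by (rule three_balls_no_common_contact[OF _ _ _ d]) (use far z V neq gr in auto)
  qed
  \<comment> \<open>For an edge, the curve runs from one grounding point through the first open part
    to a contact point w, and on through the second open part to the other grounding point.\<close>
  have joined: "\<exists>w. w \<in> T a \<inter> T b \<and> path_component (U a \<union> U b \<union> {q a, w, q b}) (q a) (q b)"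
    if e: "{a, b} \<in> ?E" for a b
  proof -
    have V: "a \<in> V" "b \<in> V" "a \<noteq> b" "path_image (\<gamma> a) \<inter> path_image (\<gamma> b) \<noteq> {}"
      using e by (auto simp: intersection_edges_def doubleton_eq_iff)
    then obtain w where w: "w \<in> T a" "w \<in> T b"
      using meet[of a b] by (auto simp: T_def)
    have "path_component (U a \<union> {q a, w}) (q a) w" "path_component (U b \<union> {w, q b}) w (q b)"
      unfolding U_def using thick_string_path gr q V w by (metis T_def)+
    then have "path_component (U a \<union> U b \<union> {q a, w, q b}) (q a) w"
      "path_component (U a \<union> U b \<union> {q a, w, q b}) w (q b)"
      by (auto elim!: path_component_of_subset[rotated])
    then show ?thesis using w path_component_trans by blast
  qed
  show ?thesis
  proof (rule noncrossing_rank[where x = "\<lambda>v. Re (q v)"])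
    show "inj_on (\<lambda>v. Re (q v)) V"
    proof (rule inj_onI, rule ccontr)
      fix u v assume uv: "u \<in> V" "v \<in> V" "Re (q u) = Re (q v)" "u \<noteq> v"
      then have "q u = q v" using q(2) by (simp add: complex_eq_iff)
      then show False using qT[of u v] q(1) uv by simp
    qed
    fix a c b d
    assume V: "a \<in> V" "c \<in> V" "b \<in> V" "d \<in> V"
      and lt: "Re (q a) < Re (q c)" "Re (q c) < Re (q b)" "Re (q b) < Re (q d)"
      and e: "{a, b} \<in> ?E" "{c, d} \<in> ?E"
    have neq: "a \<noteq> b" "a \<noteq> c" "a \<noteq> d" "b \<noteq> c" "b \<noteq> d" "c \<noteq> d"
      using lt by auto
    obtain w where w: "w \<in> T a" "w \<in> T b" and pw: "path_component (U a \<union> U b \<union> {q a, w, q b}) (q a) (q b)"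
      using joined[OF e(1)] by blast
    obtain y where y: "y \<in> T c" "y \<in> T d" and py: "path_component (U c \<union> U d \<union> {q c, y, q d}) (q c) (q d)"
      using joined[OF e(2)] by blast
    obtain f where f: "path f" "path_image f \<subseteq> U a \<union> U b \<union> {q a, w, q b}" "pathstart f = q a" "pathfinish f = q b"
      using pw by (auto simp: path_component_def)
    obtain k where k: "path k" "path_image k \<subseteq> U c \<union> U d \<union> {q c, y, q d}" "pathstart k = q c" "pathfinish k = q d"
      using py by (auto simp: path_component_def)
    have ab: "U a \<union> U b \<union> {q a, w, q b} \<subseteq> T a \<union> T b" and cd: "U c \<union> U d \<union> {q c, y, q d} \<subseteq> T c \<union> T d"
      using UT q(1) V w y by blast+
    have "path_image f \<inter> path_image k \<noteq> {}"
    proof (rule interlaced_paths_meet)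
      show "path_image f \<subseteq> {z. h \<le> Im z}" "path_image k \<subseteq> {z. h \<le> Im z}"
        using f(2) k(2) ab cd above V by blast+
    qed (use f k q lt V in simp_all)
    then obtain s where s: "s \<in> U a \<union> U b \<union> {q a, w, q b}" "s \<in> U c \<union> U d \<union> {q c, y, q d}"
      using f(2) k(2) by blast
    then have sT: "s \<in> T a \<union> T b" "s \<in> T c \<union> T d" using ab cd by blast+
    \<comment> \<open>The common point s is in no open part of a or b, since these miss the strings
      of c and d. It is not a grounding point, since these lie on one string only. So it is the
      contact point of a and b, which lies on no third string.\<close>
    have "s \<in> {q a, w, q b}"
      using s(1) sT(2) UT_disjoint V neq by blast
    moreover have "q a \<notin> T c \<union> T d" "q b \<notin> T c \<union> T d"
      using qT V neq by blast+
    ultimately have "s = w" using sT(2) by blast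
    moreover have "w \<notin> T c" "w \<notin> T d"
      using no_triple[OF w] V neq by blast+
    ultimately show False using sT(2) by blast
  qed (use \<open>finite V\<close> in simp)
qed

subsection \<open>Chords of a parabola\<close>

text \<open>On a strictly convex curve, chords cross only if their ends interlace, and every vertex
  can be approached from below.\<close>

definition parabola :: "real \<Rightarrow> complex" where
  "parabola x = Complex x (x\<^sup>2)"

text \<open>The height of a chord above the parabola factors, so chords meeting at one abscissa give
  an equation between two products.\<close>

lemma parabola_chord:
  assumes "z \<in> closed_segment (parabola x) (parabola y)" "x \<le> y"
  shows "x \<le> Re z" "Re z \<le> y" "Im z - (Re z)\<^sup>2 = (Re z - x) * (y - Re z)"
proof -
  obtain u where u: "0 \<le> u" "u \<le> 1" "z = (1 - u) *\<^sub>R parabola x + u *\<^sub>R parabola y"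
    using assms(1) by (auto simp: closed_segment_def)
  then have R: "Re z = x + u * (y - x)" and I: "Im z = (1 - u) * x\<^sup>2 + u * y\<^sup>2"
    unfolding u(3) by (simp_all add: parabola_def algebra_simps)
  have "0 \<le> u * (y - x)" "u * (y - x) \<le> 1 * (y - x)"
    using u assms(2) mult_right_mono[of u 1 "y - x"] by simp_all
  then show "x \<le> Re z" "Re z \<le> y" using R by simp_all
  show "Im z - (Re z)\<^sup>2 = (Re z - x) * (y - Re z)"
    unfolding R I by (simp add: power2_eq_square algebra_simps)
qed

text \<open>Noncrossing intervals are separated or nested. Separated ones share at most an end; for
  nested ones the difference of the two heights is a sum of nonnegative terms, which must all
  vanish.\<close>

lemma parabola_chord_zero:
  fixes t x1 x2 y1 y2 :: real
  assumes x: "x1 \<le> t" "t \<le> x2" "x1 < x2" and y: "y1 \<le> t" "t \<le> y2" "y1 < y2"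
    and eq: "(t - x1) * (x2 - t) = (t - y1) * (y2 - t)"
    and neq: "(x1, x2) \<noteq> (y1, y2)"
    and nc: "\<not> (x1 < y1 \<and> y1 < x2 \<and> x2 < y2)" "\<not> (y1 < x1 \<and> x1 < y2 \<and> y2 < x2)"
  shows "t \<in> {x1, x2} \<inter> {y1, y2}"
proof -
  have nested: "t \<in> {a1, a2} \<inter> {b1, b2}"
    if "a1 \<le> b1" "b2 \<le> a2" "(a1, a2) \<noteq> (b1, b2)" "b1 \<le> t" "t \<le> b2" "b1 < b2"
      "(t - a1) * (a2 - t) = (t - b1) * (b2 - t)" for a1 a2 b1 b2 :: real
  proof -
    \<comment> \<open>The left side is the outer height minus the inner height.\<close>
    have "(b1 - a1) * (a2 - t) + (t - b1) * (a2 - b2) = 0"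
      using that(7) by (simp add: algebra_simps)
    moreover have "0 \<le> (b1 - a1) * (a2 - t)" "0 \<le> (t - b1) * (a2 - b2)"
      using that by simp_all
    ultimately have "(b1 - a1) * (a2 - t) = 0" "(t - b1) * (a2 - b2) = 0"
      by linarith+
    then show ?thesis using that by auto
  qed
  consider "x2 \<le> y1" | "y2 \<le> x1" | "x1 \<le> y1" "y2 \<le> x2" | "y1 \<le> x1" "x2 \<le> y2"
    using nc by fastforce
  then show ?thesis
  proof cases
    case 3
    then show ?thesis using nested[of x1 y1 y2 x2] assms by auto
  next
    case 4
    then show ?thesis using nested[of y1 x1 x2 y2] assms by auto
  qed (use x y in auto)
qed

lemma convex_above_parabola: "convex {z. (Re z)\<^sup>2 \<le> Im z}"
proof (rule convexI)
  fix z w :: complex and u v :: real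
  assume z: "z \<in> {z. (Re z)\<^sup>2 \<le> Im z}" and w: "w \<in> {z. (Re z)\<^sup>2 \<le> Im z}"
    and uv: "0 \<le> u" "0 \<le> v" "u + v = 1"
  have "u * (Re z)\<^sup>2 + v * (Re w)\<^sup>2 - (u * Re z + v * Re w)\<^sup>2
      = u * (1 - u) * (Re z)\<^sup>2 + v * (1 - v) * (Re w)\<^sup>2 - 2 * u * v * Re z * Re w"
    by (simp add: power2_eq_square algebra_simps)
  also have "\<dots> = u * v * (Re z - Re w)\<^sup>2"
  proof -
    have v: "v = 1 - u" using uv by simp
    show ?thesis unfolding v by (simp add: power2_eq_square algebra_simps)
  qed
  finally have "(u * Re z + v * Re w)\<^sup>2 \<le> u * (Re z)\<^sup>2 + v * (Re w)\<^sup>2"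
    using uv by (smt (verit) mult_nonneg_nonneg zero_le_power2)
  also have "\<dots> \<le> u * Im z + v * Im w"
    using z w uv by (intro add_mono mult_left_mono) auto
  finally show "u *\<^sub>R z + v *\<^sub>R w \<in> {z. (Re z)\<^sup>2 \<le> Im z}" by simp
qed

text \<open>The complement of the convex region above the parabola is outside every subset of that
  region, and it contains points directly below \<open>parabola x\<close> arbitrarily near to
  it.\<close>

lemma parabola_in_frontier_outside:
  assumes "D \<subseteq> {z. (Re z)\<^sup>2 \<le> Im z}" "parabola x \<in> D"
  shows "parabola x \<in> frontier (outside D)"
proof -
  let ?C = "{z. (Re z)\<^sup>2 \<le> Im z}"
  have sub: "- ?C \<subseteq> outside D"
    using outside_mono[OF assms(1)] outside_convex[OF convex_above_parabola] by simp
  have "parabola x \<in> closure (outside D)"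
  proof (rule closure_approachable[THEN iffD2], intro allI impI)
    fix e :: real assume "e > 0"
    let ?y = "Complex x (x\<^sup>2 - e / 2)"
    have "?y \<in> outside D" using sub \<open>e > 0\<close> by auto
    moreover have "dist ?y (parabola x) < e"
      using \<open>e > 0\<close> by (simp add: parabola_def dist_norm complex_diff cmod_def)
    ultimately show "\<exists>y\<in>outside D. dist y (parabola x) < e" by blast
  qed
  moreover have "parabola x \<notin> interior (outside D)"
    using assms(2) interior_subset outside_no_overlap[of D] by blast
  ultimately show ?thesis by (simp add: frontier_def)
qed

theorem noncrossing_outerplanar:
  assumes graph: "finite_graph V E" and nc: "noncrossing V E pos"
  shows "outerplanar V E"
proof -
  define x where "x v = real (pos v)" for v
  have inj: "x u = x v \<longleftrightarrow> u = v" if "u \<in> V" "v \<in> V" for u v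
    using nc that by (auto simp: noncrossing_def inj_on_def x_def)
  define p where "p v = parabola (x v)" for v
  \<comment> \<open>Minimum and maximum direct each edge from left to right, whichever way its ends
    are named.\<close>
  define c where "c e = linepath (parabola (Min (x ` e))) (parabola (Max (x ` e)))" for e
  have p_inj: "inj_on p V"
    using inj by (auto simp: inj_on_def p_def parabola_def)
  have edge: "\<exists>u v. e = {u, v} \<and> u \<in> V \<and> v \<in> V \<and> x u < x v \<and> c e = linepath (p u) (p v)" if "e \<in> E" for e
  proof -
    have "e \<subseteq> V" "card e = 2" using graph that by (auto simp: finite_graph_def)
    then obtain u v where uv: "e = {u, v}" "u \<noteq> v" "u \<in> V" "v \<in> V"
      by (auto simp: card_2_iff)
    have "x u \<noteq> x v" using inj uv by simp
    then have "x u < x v \<or> x v < x u" by linarith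
    then show ?thesis
    proof
      assume "x u < x v"
      then show ?thesis using uv by (intro exI[of _ u] exI[of _ v]) (simp add: c_def p_def)
    next
      assume "x v < x u"
      then show ?thesis using uv by (intro exI[of _ v] exI[of _ u]) (simp add: c_def p_def insert_commute)
    qed
  qed
  have "plane_drawing V E p c"
    unfolding plane_drawing_def
  proof (intro conjI ballI impI)
    show "inj_on p V" by (fact p_inj)
  next
    fix e assume "e \<in> E"
    then obtain u v where uv: "e = {u, v}" "u \<in> V" "v \<in> V" "x u < x v" "c e = linepath (p u) (p v)"
      using edge by blast
    have "p u \<noteq> p v" using uv by (auto simp: p_def parabola_def)
    then show "arc (c e)" "{pathstart (c e), pathfinish (c e)} = p ` e"
      using uv by simp_all
    have "w \<in> e" if "w \<in> V" "p w \<in> closed_segment (p u) (p v)" for w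
    proof -
      \<comment> \<open>A vertex is on the parabola, so the height of the chord over it vanishes,
        which happens only at the ends of the chord.\<close>
      have "(x w - x u) * (x v - x w) = 0"
        using parabola_chord(3)[of "p w" "x u" "x v"] that uv by (simp add: p_def) (simp add: parabola_def)
      then show ?thesis using inj that uv by auto
    qed
    then show "path_image (c e) \<inter> p ` V = p ` e"
      using uv by auto
  next
    fix e f assume "e \<in> E" "f \<in> E" "e \<noteq> f"
    obtain u v where uv: "e = {u, v}" "u \<in> V" "v \<in> V" "x u < x v" "c e = linepath (p u) (p v)"
      using edge \<open>e \<in> E\<close> by blast
    obtain s t where st: "f = {s, t}" "s \<in> V" "t \<in> V" "x s < x t" "c f = linepath (p s) (p t)"
      using edge \<open>f \<in> E\<close> by blast
    have nc1: "\<not> (x u < x s \<and> x s < x v \<and> x v < x t)"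
      using noncrossingD[OF nc, of u s v t] uv st \<open>e \<in> E\<close> \<open>f \<in> E\<close> by (auto simp: x_def)
    have nc2: "\<not> (x s < x u \<and> x u < x t \<and> x t < x v)"
      using noncrossingD[OF nc, of s u t v] uv st \<open>e \<in> E\<close> \<open>f \<in> E\<close> by (auto simp: x_def)
    show "path_image (c e) \<inter> path_image (c f) \<subseteq> p ` (e \<inter> f)"
    proof
      fix z assume "z \<in> path_image (c e) \<inter> path_image (c f)"
      then have z: "z \<in> closed_segment (p u) (p v)" "z \<in> closed_segment (p s) (p t)"
        using uv st by auto
      note zu = parabola_chord[OF z(1)[unfolded p_def] less_imp_le[OF uv(4)]]
      note zs = parabola_chord[OF z(2)[unfolded p_def] less_imp_le[OF st(4)]]
      have "(x u, x v) \<noteq> (x s, x t)"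
        using \<open>e \<noteq> f\<close> uv st inj by auto
      then have "Re z \<in> {x u, x v} \<inter> {x s, x t}"
        using zu zs uv(4) st(4) nc1 nc2 by (intro parabola_chord_zero) auto
      then obtain w w' where "w \<in> {u, v}" "Re z = x w" "w' \<in> {s, t}" "Re z = x w'"
        by blast
      moreover from this have "w = w'"
        using inj[of w w'] uv(2,3) st(2,3) by auto
      ultimately have w: "w \<in> e" "w \<in> f" "Re z = x w"
        using uv(1) st(1) by auto
      have "(Re z - x u) * (x v - Re z) = 0"
        using w uv(1) by auto
      then have "Im z = (Re z)\<^sup>2"
        using zu(3) by linarith
      then have "z = p w"
        using w(3) by (simp add: p_def parabola_def complex_eq_iff)
      then show "z \<in> p ` (e \<inter> f)" using w by blast
    qed
  qed
  moreover have "p ` V \<subseteq> frontier (outside (drawing_points V E p c))"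
  proof -
    have "(Re z)\<^sup>2 \<le> Im z" if "e \<in> E" "z \<in> path_image (c e)" for e z
    proof -
      obtain u v where uv: "x u < x v" "c e = linepath (p u) (p v)" using edge \<open>e \<in> E\<close> by blast
      have "z \<in> closed_segment (parabola (x u)) (parabola (x v))"
        using that(2) uv by (simp add: p_def)
      note zz = parabola_chord[OF this less_imp_le[OF uv(1)]]
      have "0 \<le> (Re z - x u) * (x v - Re z)" using zz(1,2) by simp
      then show ?thesis using zz(3) by simp
    qed
    then have "drawing_points V E p c \<subseteq> {z. (Re z)\<^sup>2 \<le> Im z}"
      by (auto simp: drawing_points_def p_def parabola_def)
    moreover have "p v \<in> drawing_points V E p c" if "v \<in> V" for v
      using that by (simp add: drawing_points_def)
    ultimately show ?thesis
      using parabola_in_frontier_outside unfolding p_def by blast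
  qed
  ultimately show ?thesis unfolding outerplanar_def by blast
qed

subsection \<open>Combs\<close>

lemma closed_segment_vertical:
  "z \<in> closed_segment (Complex a s) (Complex a t) \<longleftrightarrow> Re z = a \<and> Im z \<in> closed_segment s t"
  by (auto simp: closed_segment_def complex_eq_iff algebra_simps)

lemma closed_segment_horizontal:
  "z \<in> closed_segment (Complex s b) (Complex t b) \<longleftrightarrow> Im z = b \<and> Re z \<in> closed_segment s t"
  by (auto simp: closed_segment_def complex_eq_iff algebra_simps)

text \<open>Strings are paths that may retrace themselves: the new path goes from t to s, back along
  g to its start, and then along all of g.\<close>

lemma path_add_segment:
  fixes g :: "real \<Rightarrow> 'a::real_normed_vector"
  assumes "path g" "s \<in> path_image g"
  obtains g' where "path g'" "path_image g' = path_image g \<union> closed_segment s t"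
proof -
  obtain \<tau> where \<tau>: "\<tau> \<in> {0..1}" "s = g \<tau>"
    using assms(2) by (auto simp: path_image_def)
  let ?b = "subpath \<tau> 0 g"
  let ?g = "linepath t s +++ (?b +++ g)"
  have b: "path ?b" "pathstart ?b = s" "pathfinish ?b = pathstart g" "path_image ?b \<subseteq> path_image g"
    using assms(1) \<tau> path_image_subpath_subset[of \<tau> 0 g] by (simp_all add: pathstart_def[of g])
  show thesis
  proof
    show "path ?g" using b assms(1) by simp
    show "path_image ?g = path_image g \<union> closed_segment s t"
      using b by (auto simp: path_image_join closed_segment_commute)
  qed
qed

lemma path_add_segments:
  fixes g :: "real \<Rightarrow> 'a::real_normed_vector"
  assumes "finite R" "path g" "\<And>w. w \<in> R \<Longrightarrow> s w \<in> path_image g"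
  shows "\<exists>g'. path g' \<and> path_image g' = path_image g \<union> (\<Union>w\<in>R. closed_segment (s w) (t w))"
  using assms
proof (induction R rule: finite_induct)
  case empty
  then show ?case by auto
next
  case (insert w R)
  then obtain g' where g': "path g'" "path_image g' = path_image g \<union> (\<Union>w\<in>R. closed_segment (s w) (t w))"
    by auto
  then have "s w \<in> path_image g'" using insert.prems by simp
  then obtain g'' where "path g''" "path_image g'' = path_image g' \<union> closed_segment (s w) (t w)"
    using path_add_segment[OF g'(1)] by blast
  then show ?case using g' by (intro exI[of _ g'']) auto
qed

text \<open>A common point q is in the closure of an open ball around a point of g, and this ball
  misses the thick string of f. An interior point of the latter could not be approached in this
  way.\<close>

lemma thick_strings_disjoint_interiors:
  assumes far: "\<And>a b. a \<in> path_image f \<Longrightarrow> b \<in> path_image g \<Longrightarrow> 2 * r \<le> dist a b" and "0 < r"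
  shows "thick_string f r \<inter> thick_string g r \<subseteq> frontier (thick_string f r)"
proof
  fix q assume q: "q \<in> thick_string f r \<inter> thick_string g r"
  then obtain b where b: "b \<in> path_image g" "dist b q \<le> r"
    by (auto simp: thick_string_iff)
  have "ball b r \<inter> thick_string f r = {}"
  proof (rule ccontr)
    assume "\<not> ?thesis"
    then obtain y a where "dist b y < r" "a \<in> path_image f" "dist a y \<le> r"
      by (auto simp: thick_string_iff)
    then show False using far[of a b] b dist_triangle2[of a b y] by linarith
  qed
  then have "interior (thick_string f r) \<inter> ball b r = {}"
    using interior_subset by blast
  then have "interior (thick_string f r) \<inter> closure (ball b r) = {}"
    by (simp add: open_Int_closure_eq_empty)
  then have "q \<notin> interior (thick_string f r)"
    using b \<open>0 < r\<close> by auto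
  then show "q \<in> frontier (thick_string f r)"
    using q closure_subset by (auto simp: frontier_def)
qed

lemma thick_strings_meet_iff:
  "thick_string f r \<inter> thick_string g r \<noteq> {} \<longleftrightarrow> (\<exists>a\<in>path_image f. \<exists>b\<in>path_image g. dist a b \<le> 2 * r)"
proof
  assume "thick_string f r \<inter> thick_string g r \<noteq> {}"
  then obtain q a b where "a \<in> path_image f" "b \<in> path_image g" "dist a q \<le> r" "dist b q \<le> r"
    by (auto simp: thick_string_iff)
  moreover from this have "dist a b \<le> 2 * r" using dist_triangle2[of a b q] by simp
  ultimately show "\<exists>a\<in>path_image f. \<exists>b\<in>path_image g. dist a b \<le> 2 * r" by blast
next
  assume "\<exists>a\<in>path_image f. \<exists>b\<in>path_image g. dist a b \<le> 2 * r"
  then obtain a b where ab: "a \<in> path_image f" "b \<in> path_image g" "dist a b \<le> 2 * r" by blast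
  then have "dist a (midpoint a b) \<le> r" "dist b (midpoint a b) \<le> r"
    by (simp_all add: dist_midpoint)
  then have "midpoint a b \<in> thick_string f r \<inter> thick_string g r"
    using ab by (auto simp: thick_string_iff)
  then show "thick_string f r \<inter> thick_string g r \<noteq> {}" by blast
qed

text \<open>
  The string of a vertex \<open>v\<close> is a comb: a vertical spine above the point \<open>pos v\<close> of the
  grounding line, and for each edge to a vertex \<open>w\<close> to the right of \<open>v\<close> a horizontal tooth that
  reaches the spine of \<open>w\<close> at height \<open>pos w - pos v\<close>. An edge nested below another one is shorter,
  so a tooth passes above the spines that it does not reach. The perturbed strings have
  all teeth shortened by the thickness \<open>2 * r\<close>, and are lifted by \<open>r\<close>.
\<close>

locale noncrossing_graph =
  fixes V :: "'a set" and E :: "'a set set" and pos :: "'a \<Rightarrow> nat" and h :: real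
  assumes graph: "finite_graph V E" and nc: "noncrossing V E pos"
begin

definition x :: "'a \<Rightarrow> real" where "x v = real (pos v)"

text \<open>High enough for the teeth that start on the spine and for those that arrive from the
  left; the 0 serves vertices without neighbours.\<close>

definition spine_height :: "'a \<Rightarrow> real" where
  "spine_height v = Max (insert 0 ((\<lambda>u. \<bar>x v - x u\<bar>) ` {u \<in> V. {u, v} \<in> E}))"

definition right_neighbours :: "'a \<Rightarrow> 'a set" where
  "right_neighbours v = {w \<in> V. {v, w} \<in> E \<and> x v < x w}"

definition comb :: "'a \<Rightarrow> complex set" where
  "comb v = closed_segment (Complex (x v) h) (Complex (x v) (h + spine_height v)) \<union>
     (\<Union>w\<in>right_neighbours v. closed_segment (Complex (x v) (h + x w - x v)) (Complex (x w) (h + x w - x v)))"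

text \<open>One continuous map perturbs a whole comb: the clipping at x v fixes the abscissa of the
  spine while the teeth are pulled back into it, and the lift makes room for the thickness above the
  grounding line.\<close>

definition shift :: "real \<Rightarrow> 'a \<Rightarrow> complex \<Rightarrow> complex" where
  "shift r v z = Complex (max (x v) (Re z - 2 * r)) (Im z + r)"

lemma finite_V: "finite V"
  using graph by (simp add: finite_graph_def)

lemma inj_x: "u \<in> V \<Longrightarrow> v \<in> V \<Longrightarrow> x u = x v \<longleftrightarrow> u = v"
  using nc by (auto simp: noncrossing_def inj_on_def x_def)

text \<open>The unit gap between spines is what makes thickness 2 * r with r \<le> 1/4
  harmless.\<close>

lemma x_gap: "x u < x v \<Longrightarrow> x u + 1 \<le> x v"
  by (simp add: x_def)

lemma spine_height_nonneg: "0 \<le> spine_height v"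
  using finite_V by (simp add: spine_height_def)

lemma spine_height_ge: "u \<in> V \<Longrightarrow> {u, v} \<in> E \<Longrightarrow> \<bar>x v - x u\<bar> \<le> spine_height v"
  unfolding spine_height_def using finite_V by (intro Max_ge) auto

lemma comb_iff:
  "z \<in> comb v \<longleftrightarrow> (Re z = x v \<and> h \<le> Im z \<and> Im z \<le> h + spine_height v) \<or>
     (\<exists>w\<in>right_neighbours v. Im z = h + x w - x v \<and> x v \<le> Re z \<and> Re z \<le> x w)"
  using spine_height_nonneg[of v]
  by (auto simp: comb_def closed_segment_vertical closed_segment_horizontal closed_segment_eq_real_ivl right_neighbours_def)

lemma comb_bounds:
  assumes "z \<in> comb v"
  shows "x v \<le> Re z" "h \<le> Im z" "Im z \<le> h + spine_height v"
proof -
  have "x w - x v \<le> spine_height v" if "w \<in> right_neighbours v" for w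
    using spine_height_ge[of w v] that by (auto simp: right_neighbours_def insert_commute)
  then show "x v \<le> Re z" "h \<le> Im z" "Im z \<le> h + spine_height v"
    using assms by (fastforce simp: comb_iff right_neighbours_def)+
qed

lemma comb_path: "\<exists>g. path g \<and> path_image g = comb v"
proof -
  let ?g = "linepath (Complex (x v) h) (Complex (x v) (h + spine_height v))"
  have "Complex (x v) (h + x w - x v) \<in> path_image ?g" if "w \<in> right_neighbours v" for w
  proof -
    have "x w - x v \<le> spine_height v" "x v < x w"
      using spine_height_ge[of w v] that by (auto simp: right_neighbours_def insert_commute)
    then show ?thesis by (simp add: closed_segment_vertical closed_segment_eq_real_ivl)
  qed
  moreover have "finite (right_neighbours v)" using finite_V by (simp add: right_neighbours_def)
  ultimately show ?thesis
    using path_add_segments[of "right_neighbours v" ?g "\<lambda>w. Complex (x v) (h + x w - x v)" "\<lambda>w. Complex (x w) (h + x w - x v)"]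
    by (simp add: comb_def)
qed

text \<open>An edge from v to a vertex beyond u or w would cross the edge from u to w. So the
  neighbours of v lie between u and w inclusively, and v is at least one unit away from both u and
  w.\<close>

lemma spine_below_edge:
  assumes V: "u \<in> V" "v \<in> V" "w \<in> V" and e: "{u, w} \<in> E" and lt: "x u < x v" "x v < x w"
  shows "spine_height v + 1 \<le> x w - x u"
proof -
  have "\<bar>x v - x y\<bar> \<le> x w - x u - 1" if "y \<in> V" "{y, v} \<in> E" for y
  proof -
    have "\<not> x y < x u"
      using noncrossingD[OF nc, of y u v w] that V e lt by (auto simp: x_def)
    moreover have "\<not> x w < x y"
      using noncrossingD[OF nc, of u v w y] that V e lt by (auto simp: x_def insert_commute)
    ultimately show ?thesis using x_gap[OF lt(1)] x_gap[OF lt(2)] by linarith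
  qed
  moreover have "0 \<le> x w - x u - 1" using x_gap[OF lt(1)] lt by simp
  ultimately have "spine_height v \<le> x w - x u - 1"
    unfolding spine_height_def using finite_V by (subst Max_le_iff) auto
  then show ?thesis by simp
qed

text \<open>The spine of u is a unit to the left of the comb of v. A tooth of u ends before the
  spine of v with more than 2 * r to spare, ends exactly 2 * r before it if it belongs to the edge
  from u to v, or passes at least a unit above it. Admitting r = 0 lets the same estimate describe
  the unperturbed combs.\<close>

lemma shifted_combs:
  assumes r: "0 \<le> r" "r \<le> 1/4" and V: "u \<in> V" "v \<in> V" and lt: "x u < x v"
    and a: "a \<in> shift r u ` comb u" and b: "b \<in> shift r v ` comb v"
  shows "2 * r \<le> dist a b" "dist a b \<le> 2 * r \<Longrightarrow> {u, v} \<in> E"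
proof -
  obtain a' b' where a': "a' \<in> comb u" "a = shift r u a'" and b': "b' \<in> comb v" "b = shift r v b'"
    using a b by blast
  have dRe: "Re b - Re a \<le> dist a b" and dIm: "Im a - Im b \<le> dist a b"
    using abs_Re_le_cmod[of "a - b"] abs_Im_le_cmod[of "a - b"] by (simp_all add: dist_norm)
  have b_bounds: "x v \<le> Re b" "Im b \<le> h + spine_height v + r"
    using b' comb_bounds[OF b'(1)] by (simp_all add: shift_def)
  note gap = x_gap[OF lt]
  have "2 * r \<le> dist a b \<and> (dist a b \<le> 2 * r \<longrightarrow> {u, v} \<in> E)"
  proof (cases "Re a' = x u")
    case True
    then have "Re a = x u" using a' r by (simp add: shift_def)
    then show ?thesis using dRe b_bounds gap r by auto
  next
    case False
    then obtain w where w: "w \<in> V" "{u, w} \<in> E" "x u < x w" "Im a' = h + x w - x u" "Re a' \<le> x w"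
      using a' by (auto simp: comb_iff right_neighbours_def)
    have a_bounds: "Re a \<le> x w - 2 * r" "Im a = h + x w - x u + r"
      using a' w x_gap[OF w(3)] r by (simp_all add: shift_def)
    consider "x w < x v" | "w = v" | "x v < x w"
      using inj_x[OF w(1) V(2)] by linarith
    then show ?thesis
    proof cases
      case 1
      then show ?thesis using dRe a_bounds b_bounds by auto
    next
      case 2
      then show ?thesis using dRe a_bounds b_bounds w by auto
    next
      case 3
      then show ?thesis
        using spine_below_edge[OF V w(1,2) lt] dIm a_bounds b_bounds r by auto
    qed
  qed
  then show "2 * r \<le> dist a b" "dist a b \<le> 2 * r \<Longrightarrow> {u, v} \<in> E" by blast+
qed

lemma adjacent_combs_near:
  assumes r: "0 \<le> r" "r \<le> 1/4" and V: "u \<in> V" "v \<in> V" and e: "{u, v} \<in> E" and lt: "x u < x v"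
  shows "\<exists>a\<in>shift r u ` comb u. \<exists>b\<in>shift r v ` comb v. dist a b \<le> 2 * r"
proof -
  \<comment> \<open>The tip of the tooth from u to v, which lies on the spine of v. The shift moves
    the tip but not the spine by 2 * r to the left.\<close>
  let ?z = "Complex (x v) (h + x v - x u)"
  have "?z \<in> comb u" "?z \<in> comb v"
    using V e lt spine_height_ge[of u v] by (auto simp: comb_iff right_neighbours_def)
  moreover have "dist (shift r u ?z) (shift r v ?z) \<le> 2 * r"
    using r x_gap[OF lt] cmod_le[of "shift r u ?z - shift r v ?z"] by (simp add: shift_def dist_norm)
  ultimately show ?thesis by blast
qed

lemma shifted_combs_far:
  assumes r: "0 \<le> r" "r \<le> 1/4" and V: "u \<in> V" "v \<in> V" and "u \<noteq> v"
    and ab: "a \<in> shift r u ` comb u" "b \<in> shift r v ` comb v"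
  shows "2 * r \<le> dist a b"
proof -
  consider "x u < x v" | "x v < x u" using inj_x[OF V] \<open>u \<noteq> v\<close> by linarith
  then show ?thesis
    using shifted_combs(1)[OF r V _ ab] shifted_combs(1)[OF r V(2,1) _ ab(2,1)]
    by cases (auto simp: dist_commute)
qed

lemma shifted_combs_near_iff:
  assumes r: "0 \<le> r" "r \<le> 1/4" and V: "u \<in> V" "v \<in> V" and "u \<noteq> v"
  shows "(\<exists>a\<in>shift r u ` comb u. \<exists>b\<in>shift r v ` comb v. dist a b \<le> 2 * r) \<longleftrightarrow> {u, v} \<in> E"
proof -
  have *: "(\<exists>a\<in>shift r u ` comb u. \<exists>b\<in>shift r v ` comb v. dist a b \<le> 2 * r) \<longleftrightarrow> {u, v} \<in> E"
    if "u \<in> V" "v \<in> V" "x u < x v" for u v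
    using shifted_combs(2)[OF r that] adjacent_combs_near[OF r that(1,2) _ that(3)] by blast
  consider "x u < x v" | "x v < x u" using inj_x[OF V] \<open>u \<noteq> v\<close> by linarith
  then show ?thesis
  proof cases
    case 1
    then show ?thesis using * V by blast
  next
    case 2
    then show ?thesis using *[OF V(2,1)] by (metis dist_commute insert_commute)
  qed
qed

lemma shift_0: "z \<in> comb v \<Longrightarrow> shift 0 v z = z"
  using comb_bounds[of z v] by (simp add: shift_def complex_eq_iff)

lemma combs_meet_iff:
  assumes "u \<in> V" "v \<in> V" "u \<noteq> v"
  shows "comb u \<inter> comb v \<noteq> {} \<longleftrightarrow> {u, v} \<in> E"
proof -
  \<comment> \<open>At r = 0 the distance condition becomes equality of points, that is,
    intersection of the combs.\<close>
  have "shift 0 v ` comb v = comb v" for v using shift_0 by force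
  then show ?thesis using shifted_combs_near_iff[of 0 u v] assms by auto
qed

lemma dist_shift:
  assumes "0 \<le> r" "z \<in> comb v"
  shows "dist (shift r v z) z \<le> 3 * r"
proof -
  have "dist (shift r v z) z \<le> \<bar>Re (shift r v z - z)\<bar> + \<bar>Im (shift r v z - z)\<bar>"
    unfolding dist_norm by (rule cmod_le)
  also have "\<bar>Re (shift r v z - z)\<bar> \<le> 2 * r"
    using assms comb_bounds[of z v] by (auto simp: shift_def)
  also have "\<bar>Im (shift r v z - z)\<bar> \<le> r"
    using assms by (simp add: shift_def)
  finally show ?thesis by simp
qed

lemma base_in_comb: "Complex (x v) h \<in> comb v"
  using spine_height_nonneg[of v] by (simp add: comb_iff)

text \<open>All centres are at height at least h + r, so a ball reaches the grounding line only
  directly below a centre at height h + r. Two strings with a common ground point would share this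
  centre, although their curves are at least 2 * r apart.\<close>

lemma grounded_shifted_combs:
  assumes r: "0 < r" "r \<le> 1/4" and im: "\<And>v. v \<in> V \<Longrightarrow> path_image (g v) = shift r v ` comb v"
  shows "grounded h V (\<lambda>v. thick_string (g v) r)"
  unfolding grounded_def
proof (intro conjI ballI impI)
  have low: "h + r \<le> Im z" if "v \<in> V" "z \<in> path_image (g v)" for v z
    using that im comb_bounds(2) by (auto simp: shift_def)
  have ball: "Im z - r \<le> Im q" if "dist z q \<le> r" for z q
    using that abs_Im_le_cmod[of "z - q"] by (simp add: dist_norm)
  fix v assume v: "v \<in> V"
  show "thick_string (g v) r \<subseteq> {z. h \<le> Im z}"
    using low[OF v] ball by (force simp: thick_string_iff)
  have "shift r v (Complex (x v) h) \<in> path_image (g v)"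
    using im[OF v] base_in_comb by blast
  moreover have "dist (shift r v (Complex (x v) h)) (Complex (x v) h) \<le> r"
    using r cmod_le[of "shift r v (Complex (x v) h) - Complex (x v) h"] by (simp add: shift_def dist_norm)
  ultimately have "Complex (x v) h \<in> thick_string (g v) r"
    by (auto simp: thick_string_iff)
  then show "thick_string (g v) r \<inter> {z. Im z = h} \<noteq> {}" by force
  fix u assume u: "u \<in> V" and "v \<noteq> u"
  show "thick_string (g v) r \<inter> thick_string (g u) r \<inter> {z. Im z = h} = {}"
  proof (rule ccontr)
    assume "\<not> ?thesis"
    then obtain q where q: "Im q = h" and "q \<in> thick_string (g v) r" "q \<in> thick_string (g u) r"
      by blast
    then obtain a b where ab: "a \<in> path_image (g v)" "b \<in> path_image (g u)"
      and d: "dist a q \<le> r" "dist b q \<le> r"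
      unfolding thick_string_iff by blast
    have eq: "z = q + Complex 0 r" if "dist z q \<le> r" "h + r \<le> Im z" for z
    proof -
      have "cmod (z - q) \<le> r" using that(1) by (simp add: dist_norm)
      then have "(cmod (z - q))\<^sup>2 \<le> r\<^sup>2" using r by (intro power_mono) auto
      then have "(Re (z - q))\<^sup>2 + (Im (z - q))\<^sup>2 \<le> r\<^sup>2" by (simp add: cmod_power2)
      moreover have "r\<^sup>2 \<le> (Im (z - q))\<^sup>2" using that(2) q r by (intro power_mono) auto
      ultimately have "(Re (z - q))\<^sup>2 \<le> 0" by linarith
      then have "Re z = Re q" by simp
      moreover have "Im z = h + r" using ball[of z q] that q abs_Im_le_cmod[of "z - q"] by (simp add: dist_norm)
      ultimately show ?thesis using q by (simp add: complex_eq_iff)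
    qed
    have "a = b" using eq[of a] eq[of b] d low v u ab by simp
    then show False
      using shifted_combs_far[of r v u a b] r im u v ab \<open>v \<noteq> u\<close> by auto
  qed
qed

lemma shift_path:
  assumes "path g"
  shows "path (shift r v \<circ> g)"
proof (rule path_continuous_image[OF assms])
  show "continuous_on (path_image g) (shift r v)"
    unfolding shift_def Complex_eq by (intro continuous_intros)
qed

theorem touching_grounded_strings_exist:
  "\<exists>\<gamma>. touching_grounded_strings h V \<gamma> \<and> E = intersection_edges V (\<lambda>v. path_image (\<gamma> v))"
proof -
  obtain \<gamma> where \<gamma>: "\<And>v. path (\<gamma> v)" "\<And>v. path_image (\<gamma> v) = comb v"
    using comb_path by metis
  have im: "path_image (shift r v \<circ> \<gamma> v) = shift r v ` comb v" for r v
    by (simp add: path_image_compose \<gamma>)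
  have "grounded h V (\<lambda>v. path_image (\<gamma> v))"
    unfolding grounded_def \<gamma>
  proof (intro conjI ballI impI)
    show "comb v \<subseteq> {z. h \<le> Im z}" for v using comb_bounds by blast
    show "comb v \<inter> {z. Im z = h} \<noteq> {}" for v using base_in_comb[of v] by force
    show "comb u \<inter> comb v \<inter> {z. Im z = h} = {}" if "u \<in> V" "v \<in> V" "u \<noteq> v" for u v
    proof -
      have "Re z = x v" if "z \<in> comb v" "Im z = h" for z v
        using that by (auto simp: comb_iff right_neighbours_def)
      then have "x u = x v" if "z \<in> comb u" "z \<in> comb v" "Im z = h" for z
        using that by metis
      then show ?thesis using inj_x[OF that(1,2)] that(3) by blast
    qed
  qed
  moreover have "touching h V \<gamma>"
    unfolding touching_def
  proof (intro allI impI)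
    fix \<epsilon> :: real assume "0 < \<epsilon>"
    \<comment> \<open>The bound 1/4 keeps the shifted combs apart, and \<epsilon> / 4 keeps the
      displacement, at most 3 * r, below \<epsilon>.\<close>
    define r where "r = min (1/4) (\<epsilon> / 4)"
    have r: "0 < r" "r \<le> 1/4" "3 * r < \<epsilon>" "r < \<epsilon>"
      using \<open>0 < \<epsilon>\<close> by (auto simp: r_def min_def)
    let ?T = "\<lambda>v. thick_string (shift r v \<circ> \<gamma> v) r"
    have far: "2 * r \<le> dist a b" if "u \<in> V" "v \<in> V" "u \<noteq> v"
      "a \<in> path_image (shift r u \<circ> \<gamma> u)" "b \<in> path_image (shift r v \<circ> \<gamma> v)" for u v a b
      using shifted_combs_far[of r u v a b] that r by (simp add: im)
    have "\<forall>v\<in>V. path (shift r v \<circ> \<gamma> v) \<and> (\<forall>t\<in>{0..1}. dist ((shift r v \<circ> \<gamma> v) t) (\<gamma> v t) < \<epsilon>) \<and> 0 < r \<and> r < \<epsilon>"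
    proof (intro ballI conjI)
      fix v t assume "t \<in> {0..1::real}"
      then have "\<gamma> v t \<in> comb v" using \<gamma>(2)[of v] by (auto simp: path_image_def)
      then show "dist ((shift r v \<circ> \<gamma> v) t) (\<gamma> v t) < \<epsilon>"
        using dist_shift[of r "\<gamma> v t" v] r by simp
    qed (use r shift_path \<gamma> in auto)
    moreover have "grounded h V ?T"
      using grounded_shifted_combs[OF r(1,2), of "\<lambda>v. shift r v \<circ> \<gamma> v"] im by simp
    moreover have "?T u \<inter> ?T v \<subseteq> frontier (?T u) \<inter> frontier (?T v) \<and>
        (?T u \<inter> ?T v \<noteq> {} \<longleftrightarrow> path_image (\<gamma> u) \<inter> path_image (\<gamma> v) \<noteq> {})"
      if uv: "u \<in> V" "v \<in> V" "u \<noteq> v" for u v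
    proof
      have "?T u \<inter> ?T v \<subseteq> frontier (?T u)"
        using far uv r by (intro thick_strings_disjoint_interiors) auto
      moreover have "?T v \<inter> ?T u \<subseteq> frontier (?T v)"
        using far[OF uv(2,1)] uv r by (intro thick_strings_disjoint_interiors) auto
      ultimately show "?T u \<inter> ?T v \<subseteq> frontier (?T u) \<inter> frontier (?T v)" by blast
      show "?T u \<inter> ?T v \<noteq> {} \<longleftrightarrow> path_image (\<gamma> u) \<inter> path_image (\<gamma> v) \<noteq> {}"
        unfolding thick_strings_meet_iff im \<gamma>
        using shifted_combs_near_iff[of r u v] combs_meet_iff[of u v] uv r by simp
    qed
    ultimately show "\<exists>\<gamma>' r.
        (\<forall>v\<in>V. path (\<gamma>' v) \<and> (\<forall>t\<in>{0..1}. dist (\<gamma>' v t) (\<gamma> v t) < \<epsilon>) \<and> 0 < r v \<and> r v < \<epsilon>) \<and>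
        grounded h V (\<lambda>v. thick_string (\<gamma>' v) (r v)) \<and>
        (\<forall>u\<in>V. \<forall>v\<in>V. u \<noteq> v \<longrightarrow>
           thick_string (\<gamma>' u) (r u) \<inter> thick_string (\<gamma>' v) (r v)
             \<subseteq> frontier (thick_string (\<gamma>' u) (r u)) \<inter> frontier (thick_string (\<gamma>' v) (r v)) \<and>
           (thick_string (\<gamma>' u) (r u) \<inter> thick_string (\<gamma>' v) (r v) \<noteq> {}
             \<longleftrightarrow> path_image (\<gamma> u) \<inter> path_image (\<gamma> v) \<noteq> {}))"
      by (intro exI[of _ "\<lambda>v. shift r v \<circ> \<gamma> v"] exI[of _ "\<lambda>_. r"] conjI ballI impI) blast+
  qed
  moreover have "E = intersection_edges V (\<lambda>v. path_image (\<gamma> v))"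
  proof (intro set_eqI iffI)
    fix e assume "e \<in> E"
    then have "e \<subseteq> V" "card e = 2" using graph by (auto simp: finite_graph_def)
    then obtain u v where "e = {u, v}" "u \<noteq> v" "u \<in> V" "v \<in> V"
      by (auto simp: card_2_iff)
    then show "e \<in> intersection_edges V (\<lambda>v. path_image (\<gamma> v))"
      using combs_meet_iff[of u v] \<open>e \<in> E\<close> by (auto simp: intersection_edges_def \<gamma>)
  next
    fix e assume "e \<in> intersection_edges V (\<lambda>v. path_image (\<gamma> v))"
    then obtain u v where "e = {u, v}" "u \<noteq> v" "u \<in> V" "v \<in> V" "comb u \<inter> comb v \<noteq> {}"
      by (auto simp: intersection_edges_def \<gamma>)
    then show "e \<in> E" using combs_meet_iff[of u v] by simp
  qed
  ultimately have "touching_grounded_strings h V \<gamma> \<and> E = intersection_edges V (\<lambda>v. path_image (\<gamma> v))"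
    unfolding touching_grounded_strings_def grounded_strings_def using \<gamma>(1) by simp
  then show ?thesis by (intro exI[of _ \<gamma>])
qed

end

theorem theorem2:
  fixes V :: "'a set" and E :: "'a set set" and h :: real
  assumes "finite_graph V E"
  shows "(\<exists>\<gamma> :: 'a \<Rightarrow> real \<Rightarrow> complex. touching_grounded_strings h V \<gamma> \<and>
            E = intersection_edges V (\<lambda>v. path_image (\<gamma> v)))
         \<longleftrightarrow> outerplanar V E"
proof
  have "finite V"
    using assms by (simp add: finite_graph_def)
  assume "\<exists>\<gamma> :: 'a \<Rightarrow> real \<Rightarrow> complex. touching_grounded_strings h V \<gamma> \<and>
            E = intersection_edges V (\<lambda>v. path_image (\<gamma> v))"
  then obtain pos where "noncrossing V E pos"
    using touching_grounded_strings_noncrossing[OF \<open>finite V\<close>] by metis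
  then show "outerplanar V E"
    using noncrossing_outerplanar[OF assms] by blast
next
  assume "outerplanar V E"
  then obtain p c where pc: "plane_drawing V E p c" "p ` V \<subseteq> frontier (outside (drawing_points V E p c))"
    by (auto simp: outerplanar_def)
  interpret d: outerplanar_drawing V E p c
    using assms pc by unfold_locales
  obtain pos where "noncrossing V E pos"
    using d.noncrossing_order by blast
  then interpret noncrossing_graph V E pos h
    using assms by unfold_locales
  show "\<exists>\<gamma> :: 'a \<Rightarrow> real \<Rightarrow> complex. touching_grounded_strings h V \<gamma> \<and>
            E = intersection_edges V (\<lambda>v. path_image (\<gamma> v))"
    by (rule touching_grounded_strings_exist)
qed

end
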